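(* Let $\mathfrak{g}$ be a simple Lie algebra, not of type $F_4$ or $E_8$, and let $\Delta=\{\alpha_1,\dots,\alpha_n\}$ be a good enumeration of its simple roots. Then there are natural bijections $${}^1\mathcal{G}_1\times\cdots\times{}^n\mathcal{G}_n\;\simeq\;{}^1W_1\times\cdots\times{}^nW_n\;\simeq\;W(\mathfrak{g}),$$ where the first is the product over $j$ of the maps ${}^j\mathcal{G}_j\to{}^jW_j$, $T\mapsto\tau_T$, and the second is $(w_1,\dots,w_n)\mapsto w_1\cdots w_n$.
   Context: **Braidless weights.** For a reduced root system with simple roots $\Delta$ and Weyl group $W$, a fundamental weight $\omega$ is *braidless* if for every $\tau\in W$: whenever $\alpha\neq\gamma$ in $\Delta$ satisfy $\langle\tau(\omega),\alpha^\vee\rangle>0$ and $\langle\tau(\omega),\gamma^\vee\rangle>0$, then $\langle\gamma,\alpha^\vee\rangle=0$. A simple root is braidless if its fundamental weight is. **Good enumeration.** Let $D$ be the Dynkin diagram of $\mathfrak{g}$. An enumeration $\Delta=\{\alpha_1,\dots,\alpha_n\}$ is *good* if, for each $i=1,\dots,n$, $\alpha_i$ is braidless for the root system with Dynkin diagram $D-\{\alpha_{i+1},\dots,\alpha_n\}$. (All simple Lie algebras except those of type $F_4$ and $E_8$ admit one.) **Cosets.** $W_j$ is the subgroup of $W(\mathfrak{g})$ generated by the simple reflections $s_1,\dots,s_j$ ($W_0$ is trivial), and ${}^jW_j$ is the set of minimal length representatives in $W_j$ of the right cosets $W_{j-1}\backslash W_j$. **The sets ${}^j\mathcal{G}_j$.**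 Fix $j$. Let $\tau_\ell$ be the longest element of ${}^jW_j$ and fix a reduced decomposition $\tau_\ell=s_{i_1}\cdots s_{i_N}$ (so $N$ depends on $j$). Any two reduced decompositions of $\tau_\ell$ differ by a series of exchanges of adjacent orthogonal (distinct commuting) simple reflections. Let $S$ be the set of permutations $\sigma$ of $\{1,\dots,N\}$ induced by such series of exchanges, so that the resulting word is $s_{i_{\sigma(1)}}\cdots s_{i_{\sigma(N)}}$. Define a directed graph $T_{i_1,\dots,i_N}$ with vertex set $\{1,\dots,N\}$, with an edge $a\to b$ if and only if $s_{i_a}$ and $s_{i_b}$ do not commute and there exist $\sigma\in S$ and $1\le l\le N-1$ with $\sigma(l)=a$, $\sigma(l+1)=b$. Then ${}^j\mathcal{G}_j$ is the set of full (induced) subgraphs $T$ of $T_{i_1,\dots,i_N}$ such that: (i) if $T$ is nonempty then $1\in T$; (ii) if $b\in T$ and $a\to b$ is an edge of $T_{i_1,\dots,i_N}$, then $a\in T$. **The element $\tau_T$.** For $T\in{}^j\mathcal{G}_j$, the vertex set of $T$ has the form $\{\sigma(1),\dots,\sigma(k)\}$ for some $k\ge0$ and $\sigma\in S$, and $\tau_T:=s_{i_{\sigma(1)}}\cdots s_{i_{\sigma(k)}}$ (the identity if $T$ is empty), which does not depend on the choice of $\sigma$. *)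

theory Defs
  imports
    "HOL-Analysis.Linear_Algebra"
    "HOL-Algebra.Bij"
    "HOL-Algebra.Generated_Groups"
    "HOL-Combinatorics.Permutations"
    "Graph_Theory.Graph_Theory"
begin

section \<open>Root systems, bases and Weyl groups\<close>

definition pairing :: "'a::euclidean_space \<Rightarrow> 'a \<Rightarrow> real" where
  \<comment> \<open>\<open>\<langle>x, \<alpha>\<^sup>\<or>\<rangle>\<close>; the first argument is the weight, the second the root whose coroot is taken\<close>
  "pairing x \<alpha> = 2 * (x \<bullet> \<alpha>) / (\<alpha> \<bullet> \<alpha>)"

definition reflection :: "'a::euclidean_space \<Rightarrow> 'a \<Rightarrow> 'a" where
  "reflection \<alpha> x = x - pairing x \<alpha> *\<^sub>R \<alpha>"

text \<open>
  Reduced crystallographic root systems.  A root system is not required to span the ambient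
  Euclidean space; its own space is \<open>span \<Phi>\<close>.  In this way \<open>\<Phi> \<inter> span X\<close> is again a root
  system of the same type, and reflections act trivially on the orthogonal complement of
  \<open>span \<Phi>\<close>, so that groups generated by them are the same as on \<open>span \<Phi>\<close>.
\<close>

definition root_system :: "'a::euclidean_space set \<Rightarrow> bool" where
  "root_system \<Phi> \<longleftrightarrow>
     finite \<Phi> \<and> 0 \<notin> \<Phi> \<and>
     (\<forall>\<alpha>\<in>\<Phi>. reflection \<alpha> ` \<Phi> = \<Phi>) \<and>
     (\<forall>\<alpha>\<in>\<Phi>. \<forall>\<beta>\<in>\<Phi>. pairing \<beta> \<alpha> \<in> \<int>) \<and>
     (\<forall>\<alpha>\<in>\<Phi>. \<forall>c. c *\<^sub>R \<alpha> \<in> \<Phi> \<longrightarrow> c = 1 \<or> c = -1)"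

definition irreducible_root_system :: "'a::euclidean_space set \<Rightarrow> bool" where
  "irreducible_root_system \<Phi> \<longleftrightarrow>
     root_system \<Phi> \<and> \<Phi> \<noteq> {} \<and>
     \<not> (\<exists>A B. A \<noteq> {} \<and> B \<noteq> {} \<and> A \<union> B = \<Phi> \<and> A \<inter> B = {} \<and> (\<forall>\<alpha>\<in>A. \<forall>\<beta>\<in>B. \<alpha> \<bullet> \<beta> = 0))"

definition simple_roots :: "'a::euclidean_space set \<Rightarrow> 'a set \<Rightarrow> bool" where
  "simple_roots \<Phi> \<Delta> \<longleftrightarrow>
     \<Delta> \<subseteq> \<Phi> \<and> independent \<Delta> \<and>
     (\<forall>\<beta>\<in>\<Phi>. \<exists>c :: 'a \<Rightarrow> nat.
        \<beta> = (\<Sum>\<alpha>\<in>\<Delta>. real (c \<alpha>) *\<^sub>R \<alpha>) \<or> \<beta> = - (\<Sum>\<alpha>\<in>\<Delta>. real (c \<alpha>) *\<^sub>R \<alpha>))"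

definition reflection_group :: "'a::euclidean_space set \<Rightarrow> ('a \<Rightarrow> 'a) set" where
  \<comment> \<open>\<open>BijGroup UNIV\<close> is the group of all bijections of the space, under composition\<close>
  "reflection_group X = generate (BijGroup UNIV) (reflection ` X)"

definition weyl_group :: "'a::euclidean_space set \<Rightarrow> ('a \<Rightarrow> 'a) set" where
  "weyl_group \<Phi> = reflection_group \<Phi>"

section \<open>Types F4 and E8\<close>

definition has_cartan_matrix :: "'a::euclidean_space set \<Rightarrow> int list list \<Rightarrow> bool" where
  "has_cartan_matrix \<Delta> C \<longleftrightarrow>
     (\<exists>\<beta>. bij_betw \<beta> {..<length C} \<Delta> \<and>
        (\<forall>i<length C. \<forall>k<length C. pairing (\<beta> i) (\<beta> k) = of_int (C ! i ! k)))"

text \<open>Cartan matrices in the numbering of Bourbaki's tables.\<close>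

definition cartan_F4 :: "int list list" where
  "cartan_F4 =
    [[ 2, -1,  0,  0],
     [-1,  2, -2,  0],
     [ 0, -1,  2, -1],
     [ 0,  0, -1,  2]]"

definition cartan_E8 :: "int list list" where
  "cartan_E8 =
    [[ 2,  0, -1,  0,  0,  0,  0,  0],
     [ 0,  2,  0, -1,  0,  0,  0,  0],
     [-1,  0,  2, -1,  0,  0,  0,  0],
     [ 0, -1, -1,  2, -1,  0,  0,  0],
     [ 0,  0,  0, -1,  2, -1,  0,  0],
     [ 0,  0,  0,  0, -1,  2, -1,  0],
     [ 0,  0,  0,  0,  0, -1,  2, -1],
     [ 0,  0,  0,  0,  0,  0, -1,  2]]"

section \<open>Braidless roots and good enumerations\<close>

definition fundamental_weight :: "'a::euclidean_space set \<Rightarrow> 'a \<Rightarrow> 'a" where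
  \<comment> \<open>for a base \<open>\<Delta>\<close>, the dual basis vector of \<open>span \<Delta>\<close> to the coroot of \<open>\<alpha>\<close>\<close>
  "fundamental_weight \<Delta> \<alpha> =
     (THE \<omega>. \<omega> \<in> span \<Delta> \<and> (\<forall>\<gamma>\<in>\<Delta>. pairing \<omega> \<gamma> = (if \<gamma> = \<alpha> then 1 else 0)))"

definition braidless_weight :: "'a::euclidean_space set \<Rightarrow> 'a set \<Rightarrow> 'a \<Rightarrow> bool" where
  "braidless_weight \<Phi> \<Delta> \<omega> \<longleftrightarrow>
     (\<forall>\<tau>\<in>weyl_group \<Phi>. \<forall>\<alpha>\<in>\<Delta>. \<forall>\<gamma>\<in>\<Delta>.
        \<alpha> \<noteq> \<gamma> \<and> pairing (\<tau> \<omega>) \<alpha> > 0 \<and> pairing (\<tau> \<omega>) \<gamma> > 0 \<longrightarrow> pairing \<gamma> \<alpha> = 0)"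

definition braidless_root :: "'a::euclidean_space set \<Rightarrow> 'a set \<Rightarrow> 'a \<Rightarrow> bool" where
  "braidless_root \<Phi> \<Delta> \<alpha> \<longleftrightarrow> braidless_weight \<Phi> \<Delta> (fundamental_weight \<Delta> \<alpha>)"

text \<open>
  Enumerations are functions \<open>\<alpha>\<close> on \<open>{1..n}\<close>.  The root system whose Dynkin diagram is
  obtained by deleting \<open>\<alpha> (i + 1), \<dots>, \<alpha> n\<close> is \<open>\<Phi> \<inter> span {\<alpha> 1, \<dots>, \<alpha> i}\<close>, with
  simple roots \<open>\<alpha> 1, \<dots>, \<alpha> i\<close>.
\<close>

definition good_enumeration ::
    "'a::euclidean_space set \<Rightarrow> 'a set \<Rightarrow> nat \<Rightarrow> (nat \<Rightarrow> 'a) \<Rightarrow> bool" where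
  "good_enumeration \<Phi> \<Delta> n \<alpha> \<longleftrightarrow>
     bij_betw \<alpha> {1..n} \<Delta> \<and>
     (\<forall>i\<in>{1..n}. braidless_root (\<Phi> \<inter> span (\<alpha> ` {1..i})) (\<alpha> ` {1..i}) (\<alpha> i))"

section \<open>Words, length and minimal coset representatives\<close>

definition word_prod :: "(nat \<Rightarrow> 'a::euclidean_space) \<Rightarrow> nat list \<Rightarrow> 'a \<Rightarrow> 'a" where
  "word_prod \<alpha> is = foldr (\<lambda>i w. reflection (\<alpha> i) \<circ> w) is id"

definition weyl_length :: "nat \<Rightarrow> (nat \<Rightarrow> 'a::euclidean_space) \<Rightarrow> ('a \<Rightarrow> 'a) \<Rightarrow> nat" where
  "weyl_length n \<alpha> w = (LEAST k. \<exists>is. set is \<subseteq> {1..n} \<and> length is = k \<and> word_prod \<alpha> is = w)"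

definition reduced_word :: "nat \<Rightarrow> (nat \<Rightarrow> 'a::euclidean_space) \<Rightarrow> nat list \<Rightarrow> bool" where
  "reduced_word n \<alpha> is \<longleftrightarrow> set is \<subseteq> {1..n} \<and> length is = weyl_length n \<alpha> (word_prod \<alpha> is)"

definition parabolic :: "(nat \<Rightarrow> 'a::euclidean_space) \<Rightarrow> nat \<Rightarrow> ('a \<Rightarrow> 'a) set" where
  "parabolic \<alpha> j = reflection_group (\<alpha> ` {1..j})"

definition min_coset_reps :: "nat \<Rightarrow> (nat \<Rightarrow> 'a::euclidean_space) \<Rightarrow> nat \<Rightarrow> ('a \<Rightarrow> 'a) set" where
  \<comment> \<open>minimal length elements of the cosets \<open>W\<^bsub>j-1\<^esub> w\<close> in \<open>W\<^sub>j\<close>; only used for \<open>j \<ge> 1\<close>\<close>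
  "min_coset_reps n \<alpha> j =
     {w \<in> parabolic \<alpha> j. \<forall>v\<in>parabolic \<alpha> (j - 1). weyl_length n \<alpha> w \<le> weyl_length n \<alpha> (v \<circ> w)}"

definition longest_rep_word ::
    "nat \<Rightarrow> (nat \<Rightarrow> 'a::euclidean_space) \<Rightarrow> nat \<Rightarrow> nat list \<Rightarrow> bool" where
  "longest_rep_word n \<alpha> j is \<longleftrightarrow>
     reduced_word n \<alpha> is \<and>
     is_arg_max (weyl_length n \<alpha>) (\<lambda>w. w \<in> min_coset_reps n \<alpha> j) (word_prod \<alpha> is)"

section \<open>The graph of a word and its initial full subgraphs\<close>

text \<open>
  The positions of a word \<open>is\<close> of length \<open>N\<close> are \<open>0, \<dots>, N - 1\<close>, in accordance with
  \<open>permute_list\<close>; position \<open>p\<close> here is vertex \<open>p + 1\<close> in one-based numbering.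
  A permutation \<open>\<sigma>\<close> stands for the word \<open>permute_list \<sigma> is\<close>, whose letter at position
  \<open>p\<close> is \<open>is ! \<sigma> p\<close>, so exchanging positions \<open>l\<close> and \<open>Suc l\<close> of that word replaces
  \<open>\<sigma>\<close> by its composition with a transposition on the right.
\<close>

definition commuting :: "'a::euclidean_space \<Rightarrow> 'a \<Rightarrow> bool" where
  "commuting \<alpha> \<beta> \<longleftrightarrow> reflection \<alpha> \<circ> reflection \<beta> = reflection \<beta> \<circ> reflection \<alpha>"

inductive_set exchange_perms :: "(nat \<Rightarrow> 'a::euclidean_space) \<Rightarrow> nat list \<Rightarrow> (nat \<Rightarrow> nat) set"
  for \<alpha> :: "nat \<Rightarrow> 'a" and "is" :: "nat list" where
  id: "id \<in> exchange_perms \<alpha> is"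
| exchange:
    "\<sigma> \<in> exchange_perms \<alpha> is \<Longrightarrow> Suc l < length is \<Longrightarrow>
     reflection (\<alpha> (is ! \<sigma> l)) \<noteq> reflection (\<alpha> (is ! \<sigma> (Suc l))) \<Longrightarrow>
     commuting (\<alpha> (is ! \<sigma> l)) (\<alpha> (is ! \<sigma> (Suc l))) \<Longrightarrow>
     \<sigma> \<circ> Transposition.transpose l (Suc l) \<in> exchange_perms \<alpha> is"

definition word_graph :: "(nat \<Rightarrow> 'a::euclidean_space) \<Rightarrow> nat list \<Rightarrow> nat pair_pre_digraph" where
  "word_graph \<alpha> is =
     \<lparr>pverts = {..<length is},
      parcs = {(a, b). a < length is \<and> b < length is \<and>
                 \<not> commuting (\<alpha> (is ! a)) (\<alpha> (is ! b)) \<and>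
                 (\<exists>\<sigma>\<in>exchange_perms \<alpha> is. \<exists>l. Suc l < length is \<and> \<sigma> l = a \<and> \<sigma> (Suc l) = b)}\<rparr>"

definition initial_subgraphs ::
    "(nat \<Rightarrow> 'a::euclidean_space) \<Rightarrow> nat list \<Rightarrow> nat pair_pre_digraph set" where
  "initial_subgraphs \<alpha> is =
     {T. induced_subgraph (with_proj T) (with_proj (word_graph \<alpha> is)) \<and>
         (pverts T \<noteq> {} \<longrightarrow> 0 \<in> pverts T) \<and>
         (\<forall>a b. b \<in> pverts T \<and> (a, b) \<in> parcs (word_graph \<alpha> is) \<longrightarrow> a \<in> pverts T)}"

definition represents ::
    "(nat \<Rightarrow> 'a::euclidean_space) \<Rightarrow> nat list \<Rightarrow> nat pair_pre_digraph \<Rightarrow> ('a \<Rightarrow> 'a) \<Rightarrow> bool" where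
  "represents \<alpha> is T w \<longleftrightarrow>
     (\<exists>\<sigma>\<in>exchange_perms \<alpha> is. \<exists>k\<le>length is.
        pverts T = \<sigma> ` {..<k} \<and> w = word_prod \<alpha> (take k (permute_list \<sigma> is)))"

definition tau :: "(nat \<Rightarrow> 'a::euclidean_space) \<Rightarrow> nat list \<Rightarrow> nat pair_pre_digraph \<Rightarrow> 'a \<Rightarrow> 'a" where
  "tau \<alpha> is T = (THE w. represents \<alpha> is T w)"

end

theory Submission
  imports Defs
begin

text \<open>
  Write \<open>\<omega>\<close> for the fundamental weight of \<open>\<alpha> j\<close> in \<open>W\<^sub>j\<close>.  Reduced words of minimal
  representatives of \<open>W\<^bsub>j-1\<^esub>\<close>-cosets in \<open>W\<^sub>j\<close> are exactly the words along which the successive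
  reflections, applied to \<open>\<omega>\<close>, go down at every step, and those of the longest
  representative are the ones that end in an antidominant weight.  If \<open>\<omega>\<close> is braidless, two
  simple reflections that both lower the same weight in the orbit commute, so a descent that
  is available stays available until it is used, and its letter can be pulled to the front.
  Hence two descending words are equivalent under commutations as soon as they have the same
  letters, or the same end point, or both end in antidominant weights.  So every minimal
  representative is a prefix of a word in the commutation class of the longest one, that is,
  an initial subgraph, and the number of occurrences of each letter determines the subgraph
  since exchanges never change the order of equal letters.  Finally, a coset \<open>W\<^bsub>j-1\<^esub> w\<close>
  determines the end point \<open>w\<^sup>-\<^sup>1 \<omega>\<close>, so its minimal representative is unique.
\<close>

section \<open>Reflections and words\<close>

lemma pairing_eq_0_iff: "pairing x a = 0 \<longleftrightarrow> x \<bullet> a = 0"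
  by (auto simp: pairing_def)

lemma pairing_pos_iff: "pairing x a > 0 \<longleftrightarrow> x \<bullet> a > 0"
  using inner_ge_zero[of a] by (auto simp: pairing_def zero_less_divide_iff not_less[symmetric])

lemma linear_reflection: "linear (reflection a)"
  by (rule linearI)
    (simp_all add: reflection_def pairing_def inner_left_distrib add_divide_distrib algebra_simps)

lemma reflection_self: "reflection a a = - a"
  by (cases "a = 0") (simp_all add: reflection_def pairing_def scaleR_2)

lemma reflection_orthogonal: "x \<bullet> a = 0 \<Longrightarrow> reflection a x = x"
  by (simp add: reflection_def pairing_def)

lemma reflection_reflection [simp]: "reflection a (reflection a x) = x"
proof -
  have "reflection a (reflection a x) = reflection a x - pairing x a *\<^sub>R reflection a a"
    using linear_reflection[of a]
    by (subst (2) reflection_def) (simp add: linear_diff linear_scale)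
  then show ?thesis
    by (simp add: reflection_self) (simp add: reflection_def)
qed

lemma reflection_comp_self [simp]: "reflection a \<circ> reflection a = id"
  by auto

lemma reflection_comp_cancel [simp]: "reflection a \<circ> (reflection a \<circ> f) = f"
  by auto

lemma bij_reflection: "bij (reflection a)"
  by (rule o_bij[of "reflection a"]) simp_all

lemma inner_reflection_left: "reflection a x \<bullet> y = x \<bullet> reflection a y"
  by (simp add: reflection_def pairing_def inner_diff_left inner_diff_right inner_commute)

lemma inner_reflection [simp]: "reflection a x \<bullet> reflection a y = x \<bullet> y"
  by (simp add: inner_reflection_left)

text \<open>The formula for a reflection uses only the linear structure and the inner product, and
  \<open>f\<close> preserves both.\<close>

lemma reflection_conj:
  assumes "linear f" and "\<And>x y. f x \<bullet> f y = x \<bullet> y"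
  shows "reflection (f a) \<circ> f = f \<circ> reflection a"
  using assms by (auto simp: fun_eq_iff reflection_def pairing_def linear_diff linear_scale)

lemma reflection_uminus: "reflection (- a) = reflection a"
  by (simp add: fun_eq_iff reflection_def pairing_def)

lemma commuting_orthogonal:
  assumes "a \<bullet> b = 0"
  shows "commuting a b"
proof -
  have "reflection a b = b" using assms by (simp add: reflection_orthogonal inner_commute)
  then show ?thesis
    using reflection_conj[OF linear_reflection[of a] inner_reflection, of b]
    by (simp add: commuting_def)
qed

section \<open>Words in the reflections and the groups they form\<close>

lemma word_prod_Nil [simp]: "word_prod \<alpha> [] = id"
  by (simp add: word_prod_def)

lemma word_prod_Cons [simp]: "word_prod \<alpha> (i # p) = reflection (\<alpha> i) \<circ> word_prod \<alpha> p"
  by (simp add: word_prod_def)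

lemma word_prod_append [simp]: "word_prod \<alpha> (p @ q) = word_prod \<alpha> p \<circ> word_prod \<alpha> q"
  by (induction p) (simp_all add: comp_assoc)

lemma linear_word_prod: "linear (word_prod \<alpha> p)"
  by (induction p)
    (simp_all add: linear_ident linear_compose[OF _ linear_reflection, unfolded o_def] o_def id_def)

lemma inner_word_prod [simp]: "word_prod \<alpha> p x \<bullet> word_prod \<alpha> p y = x \<bullet> y"
  by (induction p) simp_all

lemma word_prod_rev_cancel [simp]:
  "word_prod \<alpha> p \<circ> word_prod \<alpha> (rev p) = id" "word_prod \<alpha> (rev p) \<circ> word_prod \<alpha> p = id"
  by (induction p) (auto simp: fun_eq_iff)

lemma word_prod_rev_cancel_apply [simp]:
  "word_prod \<alpha> p (word_prod \<alpha> (rev p) x) = x" "word_prod \<alpha> (rev p) (word_prod \<alpha> p x) = x"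
  by (simp_all add: word_prod_rev_cancel[THEN fun_cong, unfolded o_apply id_apply])

text \<open>The adjoint of an isometry is its inverse, and reversing a word inverts it. This moves a
  word from the weight to the root and back.\<close>

lemma inner_word_prod_rev: "word_prod \<alpha> (rev p) x \<bullet> y = x \<bullet> word_prod \<alpha> p y"
  by (metis inner_word_prod word_prod_rev_cancel_apply(2))

lemma word_prod_rev_eqI: "word_prod \<alpha> p = word_prod \<alpha> q \<Longrightarrow> word_prod \<alpha> (rev p) = word_prod \<alpha> (rev q)"
  by (metis comp_assoc comp_id id_comp word_prod_rev_cancel)

lemma bij_word_prod: "bij (word_prod \<alpha> p)"
  by (rule o_bij[of "word_prod \<alpha> (rev p)"]) simp_all

lemma word_prod_span:
  assumes "set p \<subseteq> I" and "x \<in> span (\<alpha> ` I)"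
  shows "word_prod \<alpha> p x \<in> span (\<alpha> ` I)"
  using assms
  by (induction p) (auto simp: reflection_def intro!: span_diff span_scale intro: span_base)

text \<open>Reflections are involutions, so inverses of generators are again generators and every
  element of the generated group is a plain word.\<close>

lemma reflection_group_eq:
  "reflection_group (\<alpha> ` I) = {word_prod \<alpha> p |p. set p \<subseteq> I}"
proof -
  have carrier: "f \<in> carrier (BijGroup UNIV) \<longleftrightarrow> bij f" for f :: "'a \<Rightarrow> 'a"
    by (simp add: BijGroup_def Bij_def)
  have mult: "f \<otimes>\<^bsub>BijGroup UNIV\<^esub> g = f \<circ> g" if "bij f" "bij g" for f g :: "'a \<Rightarrow> 'a"
    using that by (simp add: BijGroup_def Bij_def compose_def fun_eq_iff)
  have one_eq: "\<one>\<^bsub>BijGroup UNIV\<^esub> = (id :: 'a \<Rightarrow> 'a)"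
    by (simp add: BijGroup_def fun_eq_iff)
  interpret group "BijGroup (UNIV :: 'a set)" by (rule group_BijGroup)
  have inv_eq: "inv\<^bsub>BijGroup UNIV\<^esub> (reflection a) = reflection a" for a :: 'a
    by (rule inv_equality) (simp_all add: carrier mult one_eq bij_reflection)
  show ?thesis
  proof (intro equalityI subsetI)
    fix w assume "w \<in> reflection_group (\<alpha> ` I)"
    then have "w \<in> generate (BijGroup UNIV) (reflection ` \<alpha> ` I)"
      by (simp add: reflection_group_def)
    then show "w \<in> {word_prod \<alpha> p |p. set p \<subseteq> I}"
    proof induction
      case one
      show ?case by (auto simp: one_eq intro!: exI[of _ "[]"])
    next
      case (incl h)
      then obtain i where "i \<in> I" "h = reflection (\<alpha> i)" by auto
      then show ?case by (auto intro!: exI[of _ "[i]"])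
    next
      case (inv h)
      then obtain i where "i \<in> I" "h = reflection (\<alpha> i)" by auto
      then show ?case by (auto simp: inv_eq intro!: exI[of _ "[i]"])
    next
      case (eng h1 h2)
      then obtain p q where "set p \<subseteq> I" "h1 = word_prod \<alpha> p" "set q \<subseteq> I" "h2 = word_prod \<alpha> q"
        by auto
      then show ?case by (auto simp: mult bij_word_prod intro!: exI[of _ "p @ q"])
    qed
  next
    fix w assume "w \<in> {word_prod \<alpha> p |p. set p \<subseteq> I}"
    then obtain p where p: "set p \<subseteq> I" and w: "w = word_prod \<alpha> p" by auto
    from p have "word_prod \<alpha> p \<in> generate (BijGroup UNIV) (reflection ` \<alpha> ` I)"
    proof (induction p)
      case Nil
      then show ?case by (metis one_eq word_prod_Nil generate.one)
    next
      case (Cons i p)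
      then have "reflection (\<alpha> i) \<otimes>\<^bsub>BijGroup UNIV\<^esub> word_prod \<alpha> p
          \<in> generate (BijGroup UNIV) (reflection ` \<alpha> ` I)"
        by (intro generate.eng) (auto intro: generate.incl)
      then show ?case by (simp only: mult[OF bij_reflection bij_word_prod] word_prod_Cons)
    qed
    then show "w \<in> reflection_group (\<alpha> ` I)" by (simp add: w reflection_group_def)
  qed
qed

lemma parabolic_eq: "parabolic \<alpha> j = {word_prod \<alpha> p |p. set p \<subseteq> {1..j}}"
  by (simp add: parabolic_def reflection_group_eq)

lemma word_prod_in_parabolic: "set p \<subseteq> {1..j} \<Longrightarrow> word_prod \<alpha> p \<in> parabolic \<alpha> j"
  by (auto simp: parabolic_eq)

lemma parabolic_comp: "v \<in> parabolic \<alpha> j \<Longrightarrow> w \<in> parabolic \<alpha> j \<Longrightarrow> v \<circ> w \<in> parabolic \<alpha> j"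
  unfolding parabolic_eq by (clarsimp, metis Un_least set_append word_prod_append)

lemma parabolic_mono: "i \<le> j \<Longrightarrow> parabolic \<alpha> i \<subseteq> parabolic \<alpha> j"
  unfolding parabolic_eq by fastforce

lemma parabolic_inverse:
  assumes "v \<in> parabolic \<alpha> j"
  obtains v' where "v' \<in> parabolic \<alpha> j" "v \<circ> v' = id" "v' \<circ> v = id"
  using assms unfolding parabolic_eq by (clarsimp, metis set_rev word_prod_rev_cancel)

lemma parabolic_0: "parabolic \<alpha> 0 = {id}"
  by (auto simp: parabolic_eq)

section \<open>Dual vectors and fundamental weights\<close>

lemma exists_dual_vector:
  fixes B :: "'a::euclidean_space set"
  assumes "independent B"
  obtains d where "d \<in> span B" "\<And>b. b \<in> B \<Longrightarrow> d \<bullet> b = g b"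
proof -
  obtain f :: "'a \<Rightarrow> real" where f: "linear f" "\<And>b. b \<in> B \<Longrightarrow> f b = g b"
    using linear_independent_extend[OF assms, of g] by blast
  obtain d e where d: "d \<in> span B" and e: "\<And>w. w \<in> span B \<Longrightarrow> orthogonal e w"
    and sum: "adjoint f 1 = d + e"
    using orthogonal_subspace_decomp_exists[of B "adjoint f 1"] by blast
  have "d \<bullet> b = g b" if "b \<in> B" for b
  proof -
    have "d \<bullet> b = adjoint f 1 \<bullet> b"
      using e[OF span_base[OF that]] by (simp add: sum inner_add_left orthogonal_def)
    also have "\<dots> = f b" using adjoint_works[OF f(1), of b 1] by (simp add: inner_commute)
    finally show ?thesis using f(2) that by simp
  qed
  with d that show thesis by blast
qed

text \<open>This resolves the definite description. A dual vector with value
  \<open>b \<bullet> b / 2\<close> at \<open>b = a\<close> has the required pairings, and the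
  difference of two candidates lies in \<open>span \<Delta>\<close> and is orthogonal to it.\<close>

lemma fundamental_weight_props:
  fixes \<Delta> :: "'a::euclidean_space set"
  assumes "independent \<Delta>"
  shows "fundamental_weight \<Delta> a \<in> span \<Delta>"
    and "\<And>b. b \<in> \<Delta> \<Longrightarrow> pairing (fundamental_weight \<Delta> a) b = (if b = a then 1 else 0)"
proof -
  let ?P = "\<lambda>\<omega>. \<omega> \<in> span \<Delta> \<and> (\<forall>b\<in>\<Delta>. pairing \<omega> b = (if b = a then 1 else 0))"
  obtain d where d: "d \<in> span \<Delta>" "\<And>b. b \<in> \<Delta> \<Longrightarrow> d \<bullet> b = (if b = a then b \<bullet> b / 2 else 0)"
    using exists_dual_vector[OF assms, of "\<lambda>b. if b = a then b \<bullet> b / 2 else 0"] by blast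
  have nz: "b \<noteq> 0" if "b \<in> \<Delta>" for b using that assms dependent_zero by blast
  have "?P d" using d nz by (auto simp: pairing_def)
  moreover have "x = d" if "?P x" for x
  proof -
    have "(x - d) \<bullet> b = 0" if "b \<in> \<Delta>" for b
    proof -
      have "pairing x b = pairing d b" using that \<open>?P x\<close> \<open>?P d\<close> by simp
      then show ?thesis using nz[OF that] by (simp add: pairing_def inner_diff_left)
    qed
    then have "orthogonal (x - d) y" if "y \<in> span \<Delta>" for y
      using orthogonal_to_span[OF that] by (auto simp: orthogonal_def)
    then have "orthogonal (x - d) (x - d)" using \<open>?P x\<close> d(1) by (blast intro: span_diff)
    then show ?thesis by (simp add: orthogonal_def)
  qed
  ultimately have "?P (fundamental_weight \<Delta> a)"
    unfolding fundamental_weight_def by (rule theI)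
  then show "fundamental_weight \<Delta> a \<in> span \<Delta>"
    and "\<And>b. b \<in> \<Delta> \<Longrightarrow> pairing (fundamental_weight \<Delta> a) b = (if b = a then 1 else 0)"
    by auto
qed

section \<open>Positive roots and the exchange condition\<close>

text \<open>Keeps index ranges such as \<open>{1..n}\<close> from being rewritten with
  \<open>Suc 0\<close>.\<close>

declare One_nat_def [simp del]

locale based_root_system =
  fixes \<Phi> :: "'a::euclidean_space set" and n :: nat and \<alpha> :: "nat \<Rightarrow> 'a"
  assumes root_system: "root_system \<Phi>"
    and simple: "simple_roots \<Phi> (\<alpha> ` {1..n})"
    and inj: "inj_on \<alpha> {1..n}"
begin

abbreviation s :: "nat \<Rightarrow> 'a \<Rightarrow> 'a" where "s i \<equiv> reflection (\<alpha> i)"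
abbreviation wp :: "nat list \<Rightarrow> 'a \<Rightarrow> 'a" where "wp \<equiv> word_prod \<alpha>"

lemma simple_in_roots: "i \<in> {1..n} \<Longrightarrow> \<alpha> i \<in> \<Phi>"
  using simple by (auto simp: simple_roots_def)

lemma independent_simple: "X \<subseteq> {1..n} \<Longrightarrow> independent (\<alpha> ` X)"
  using simple independent_mono[OF _ image_mono] unfolding simple_roots_def by blast

lemma roots_nonzero: "\<beta> \<in> \<Phi> \<Longrightarrow> \<beta> \<noteq> 0"
  using root_system by (auto simp: root_system_def)

lemma reflection_in_roots: "\<beta> \<in> \<Phi> \<Longrightarrow> \<gamma> \<in> \<Phi> \<Longrightarrow> reflection \<beta> \<gamma> \<in> \<Phi>"
  using root_system by (auto simp: root_system_def)

lemma uminus_in_roots: "\<beta> \<in> \<Phi> \<Longrightarrow> - \<beta> \<in> \<Phi>"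
  using reflection_in_roots[of \<beta> \<beta>] by (simp add: reflection_self)

lemma word_prod_in_roots: "set p \<subseteq> {1..n} \<Longrightarrow> \<beta> \<in> \<Phi> \<Longrightarrow> wp p \<beta> \<in> \<Phi>"
  by (induction p) (auto intro!: reflection_in_roots simple_in_roots)

text \<open>On \<open>span \<Phi>\<close> the inner product with \<open>dual i\<close> reads off the
  coefficient of \<open>\<alpha> i\<close> in the expansion in simple roots. The roots need not span
  the space, so such a vector is chosen rather than unique.\<close>

definition dual :: "nat \<Rightarrow> 'a" where
  "dual i = (SOME d. \<forall>k\<in>{1..n}. d \<bullet> \<alpha> k = (if k = i then 1 else 0))"

lemma inner_dual:
  assumes "k \<in> {1..n}"
  shows "dual i \<bullet> \<alpha> k = (if k = i then 1 else 0)"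
proof -
  obtain d where "\<And>b. b \<in> \<alpha> ` {1..n} \<Longrightarrow>
      d \<bullet> b = (if the_inv_into {1..n} \<alpha> b = i then 1 else 0)"
    using exists_dual_vector[OF independent_simple[OF order_refl],
        of "\<lambda>b. if the_inv_into {1..n} \<alpha> b = i then 1 else 0"] by metis
  then have "\<forall>k\<in>{1..n}. d \<bullet> \<alpha> k = (if k = i then 1 else 0)"
    by (auto simp: the_inv_into_f_f[OF inj])
  then have "\<forall>k\<in>{1..n}. dual i \<bullet> \<alpha> k = (if k = i then 1 else 0)"
    unfolding dual_def by (rule someI)
  with assms show ?thesis by blast
qed

lemma inner_dual_sum:
  assumes "k \<in> {1..n}"
  shows "dual k \<bullet> (\<Sum>i\<in>{1..n}. c i *\<^sub>R \<alpha> i) = c k"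
  using assms by (simp add: inner_sum_right inner_dual if_distrib[of "(*) _"] cong: if_cong)

definition pos :: "'a \<Rightarrow> bool" where
  "pos \<beta> \<longleftrightarrow> \<beta> \<in> \<Phi> \<and> (\<forall>k\<in>{1..n}. dual k \<bullet> \<beta> \<ge> 0)"

lemma root_coefficients:
  assumes "\<beta> \<in> \<Phi>"
  obtains c :: "nat \<Rightarrow> nat" where
    "\<beta> = (\<Sum>i\<in>{1..n}. real (c i) *\<^sub>R \<alpha> i) \<or> - \<beta> = (\<Sum>i\<in>{1..n}. real (c i) *\<^sub>R \<alpha> i)"
proof -
  obtain c :: "'a \<Rightarrow> nat" where "\<beta> = (\<Sum>a\<in>\<alpha> ` {1..n}. real (c a) *\<^sub>R a) \<or>
      \<beta> = - (\<Sum>a\<in>\<alpha> ` {1..n}. real (c a) *\<^sub>R a)"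
    using simple assms unfolding simple_roots_def by blast
  then show thesis
    using that[of "\<lambda>i. c (\<alpha> i)"] by (auto simp: sum.reindex[OF inj])
qed

lemma root_cases:
  assumes "\<beta> \<in> \<Phi>"
  obtains (pos) "pos \<beta>" | (neg) "pos (- \<beta>)"
proof -
  obtain c :: "nat \<Rightarrow> nat" where
    "\<beta> = (\<Sum>i\<in>{1..n}. real (c i) *\<^sub>R \<alpha> i) \<or> - \<beta> = (\<Sum>i\<in>{1..n}. real (c i) *\<^sub>R \<alpha> i)"
    by (rule root_coefficients[OF assms])
  then show thesis
  proof
    assume \<beta>: "\<beta> = (\<Sum>i\<in>{1..n}. real (c i) *\<^sub>R \<alpha> i)"
    have "dual k \<bullet> \<beta> \<ge> 0" if "k \<in> {1..n}" for k
      unfolding \<beta> inner_dual_sum[OF that] by simp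
    then show thesis using assms pos by (simp add: pos_def)
  next
    assume \<beta>: "- \<beta> = (\<Sum>i\<in>{1..n}. real (c i) *\<^sub>R \<alpha> i)"
    have "dual k \<bullet> - \<beta> \<ge> 0" if "k \<in> {1..n}" for k
      unfolding \<beta> inner_dual_sum[OF that] by simp
    then show thesis using uminus_in_roots[OF assms] neg by (simp add: pos_def)
  qed
qed

lemma root_expansion:
  assumes "\<beta> \<in> \<Phi>"
  shows "\<beta> = (\<Sum>i\<in>{1..n}. (dual i \<bullet> \<beta>) *\<^sub>R \<alpha> i)"
proof -
  obtain c :: "nat \<Rightarrow> nat" where
    "\<beta> = (\<Sum>i\<in>{1..n}. real (c i) *\<^sub>R \<alpha> i) \<or> - \<beta> = (\<Sum>i\<in>{1..n}. real (c i) *\<^sub>R \<alpha> i)"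
    by (rule root_coefficients[OF assms])
  then have "\<beta> = (\<Sum>i\<in>{1..n}. real (c i) *\<^sub>R \<alpha> i) \<or>
      \<beta> = (\<Sum>i\<in>{1..n}. (- real (c i)) *\<^sub>R \<alpha> i)"
    by (auto simp: sum_negf minus_equation_iff[of \<beta>])
  then obtain d where d: "\<beta> = (\<Sum>i\<in>{1..n}. d i *\<^sub>R \<alpha> i)"
    by (elim disjE) (rule that, assumption)+
  have "dual i \<bullet> \<beta> = d i" if "i \<in> {1..n}" for i
    using inner_dual_sum[OF that] d by simp
  then have "(\<Sum>i\<in>{1..n}. (dual i \<bullet> \<beta>) *\<^sub>R \<alpha> i) = (\<Sum>i\<in>{1..n}. d i *\<^sub>R \<alpha> i)"
    by (intro sum.cong) simp_all
  with d show ?thesis by simp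
qed

lemma not_pos_uminus:
  assumes "pos \<beta>"
  shows "\<not> pos (- \<beta>)"
proof
  assume "pos (- \<beta>)"
  with assms have "\<forall>i\<in>{1..n}. dual i \<bullet> \<beta> = 0"
    by (auto simp: pos_def intro: antisym)
  moreover have "\<beta> \<in> \<Phi>" using assms by (simp add: pos_def)
  ultimately have "\<beta> = 0" using root_expansion[of \<beta>] by simp
  with \<open>\<beta> \<in> \<Phi>\<close> roots_nonzero show False by blast
qed

lemma pos_simple: "i \<in> {1..n} \<Longrightarrow> pos (\<alpha> i)"
  by (simp add: pos_def simple_in_roots inner_dual)

text \<open>Applying \<open>s i\<close> changes only the coefficient of \<open>\<alpha> i\<close>.
  Since the root system is reduced, a positive root other than \<open>\<alpha> i\<close> has some
  other positive coefficient; it survives and rules out a negative root.\<close>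

lemma reflection_pos:
  assumes "pos \<beta>" and i: "i \<in> {1..n}" and "\<beta> \<noteq> \<alpha> i"
  shows "pos (s i \<beta>)"
proof -
  have \<beta>: "\<beta> \<in> \<Phi>" using assms(1) by (simp add: pos_def)
  have "\<exists>k\<in>{1..n}. k \<noteq> i \<and> dual k \<bullet> \<beta> > 0"
  proof (rule ccontr)
    assume "\<not> ?thesis"
    then have zero: "dual k \<bullet> \<beta> = 0" if "k \<in> {1..n}" "k \<noteq> i" for k
      using that assms(1) by (force simp: pos_def)
    have "\<beta> = (\<Sum>k\<in>{1..n}. (dual k \<bullet> \<beta>) *\<^sub>R \<alpha> k)" by (rule root_expansion[OF \<beta>])
    also have "\<dots> = (\<Sum>k\<in>{1..n}. if k = i then (dual i \<bullet> \<beta>) *\<^sub>R \<alpha> i else 0)"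
      using zero by (intro sum.cong) auto
    finally have eq: "\<beta> = (dual i \<bullet> \<beta>) *\<^sub>R \<alpha> i" using i by simp
    then have "dual i \<bullet> \<beta> = 1 \<or> dual i \<bullet> \<beta> = -1"
      using root_system simple_in_roots[OF i] \<beta> unfolding root_system_def by metis
    moreover have "dual i \<bullet> \<beta> \<ge> 0" using assms(1) i by (simp add: pos_def)
    ultimately show False using eq assms(3) by auto
  qed
  then obtain k where k: "k \<in> {1..n}" "k \<noteq> i" "dual k \<bullet> \<beta> > 0" by blast
  have "dual k \<bullet> s i \<beta> = dual k \<bullet> \<beta>"
    using k i by (simp add: reflection_def inner_diff_right inner_dual)
  then have "\<not> pos (- s i \<beta>)" using k by (force simp: pos_def)
  with reflection_in_roots[OF simple_in_roots[OF i] \<beta>] show ?thesis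
    using root_cases by blast
qed

text \<open>The letters of \<open>p\<close> act on \<open>\<beta>\<close> from left to right. At the
  first one that produces a negative root the current root must be that simple root itself, by
  \<open>reflection_pos\<close>.\<close>

lemma pos_neg_word_split:
  assumes "pos \<beta>" and "set p \<subseteq> {1..n}" and "pos (- wp (rev p) \<beta>)"
  obtains p1 k p2 where "p = p1 @ k # p2" and "wp (rev p1) \<beta> = \<alpha> k"
proof -
  have "\<exists>p1 k p2. p = p1 @ k # p2 \<and> wp (rev p1) \<beta> = \<alpha> k"
    using assms
  proof (induction p arbitrary: \<beta>)
    case Nil
    then show ?case using not_pos_uminus by auto
  next
    case (Cons k p)
    show ?case
    proof (cases "\<beta> = \<alpha> k")
      case True
      then show ?thesis by (intro exI[of _ "[]"]) simp
    next
      case False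
      then have "pos (s k \<beta>)" using Cons.prems by (intro reflection_pos) auto
      with Cons.prems Cons.IH[of "s k \<beta>"] obtain p1 l p2
        where "p = p1 @ l # p2" "wp (rev p1) (s k \<beta>) = \<alpha> l" by auto
      then show ?thesis by (intro exI[of _ "k # p1"]) simp
    qed
  qed
  with that show thesis by blast
qed

text \<open>The letter \<open>k\<close> at which \<open>\<alpha> i\<close> turns negative satisfies
  \<open>s i \<circ> wp p1 = wp p1 \<circ> s k\<close>, so multiplying by \<open>s i\<close> on the
  left cancels exactly that letter.\<close>

lemma exchange:
  assumes i: "i \<in> {1..n}" and p: "set p \<subseteq> {1..n}" and neg: "pos (- wp (rev p) (\<alpha> i))"
  obtains q where "set q \<subseteq> {1..n}" and "Suc (length q) = length p" and "wp q = s i \<circ> wp p"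
proof -
  obtain p1 k p2 where split: "p = p1 @ k # p2" and eq: "wp (rev p1) (\<alpha> i) = \<alpha> k"
    by (rule pos_neg_word_split[OF pos_simple[OF i] p neg])
  have "wp p1 (\<alpha> k) = \<alpha> i" using eq word_prod_rev_cancel_apply(1) by metis
  then have "s i \<circ> wp p1 = wp p1 \<circ> s k"
    using reflection_conj[OF linear_word_prod inner_word_prod, of \<alpha> p1 "\<alpha> k"] by simp
  then have "s i \<circ> wp p = wp p1 \<circ> (s k \<circ> (s k \<circ> wp p2))"
    by (metis split comp_assoc word_prod_Cons word_prod_append)
  then have "wp (p1 @ p2) = s i \<circ> wp p" by simp
  with that[of "p1 @ p2"] p split show thesis by simp
qed

section \<open>Length and reduced words\<close>

abbreviation L :: "('a \<Rightarrow> 'a) \<Rightarrow> nat" where "L \<equiv> weyl_length n \<alpha>"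
abbreviation reduced :: "nat list \<Rightarrow> bool" where "reduced \<equiv> reduced_word n \<alpha>"

lemma weyl_length_le: "set p \<subseteq> {1..n} \<Longrightarrow> L (wp p) \<le> length p"
  unfolding weyl_length_def by (rule Least_le) blast

lemma exists_reduced:
  assumes "w \<in> parabolic \<alpha> n"
  obtains p where "reduced p" and "wp p = w"
proof -
  have "\<exists>k p. set p \<subseteq> {1..n} \<and> length p = k \<and> wp p = w"
    using assms by (auto simp: parabolic_eq)
  then have "\<exists>p. set p \<subseteq> {1..n} \<and> length p = L w \<and> wp p = w"
    unfolding weyl_length_def by (rule LeastI_ex)
  with that show thesis by (auto simp: reduced_word_def)
qed

lemma weyl_length_reflection_less:
  assumes "i \<in> {1..n}" and "set p \<subseteq> {1..n}" and "pos (- wp (rev p) (\<alpha> i))"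
  shows "L (s i \<circ> wp p) < L (wp p)"
proof -
  obtain q where q: "reduced q" "wp q = wp p"
    using exists_reduced[of "wp p"] word_prod_in_parabolic[of p n] assms(2) by auto
  then have "pos (- wp (rev q) (\<alpha> i))" using assms(3) word_prod_rev_eqI by metis
  with q assms(1) obtain r where "set r \<subseteq> {1..n}" "Suc (length r) = length q"
      "wp r = s i \<circ> wp q"
    using exchange[of i q] by (auto simp: reduced_word_def)
  with q show ?thesis using weyl_length_le[of r] by (simp add: reduced_word_def)
qed

text \<open>Prepending \<open>i\<close> flips the sign of the root, so the preceding lemma applies
  to \<open>i # p\<close>, and \<open>s i\<close> cancels against the new letter.\<close>

lemma weyl_length_reflection_greater:
  assumes i: "i \<in> {1..n}" and p: "set p \<subseteq> {1..n}" and "pos (wp (rev p) (\<alpha> i))"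
  shows "L (wp p) < L (s i \<circ> wp p)"
proof -
  have "pos (- wp (rev (i # p)) (\<alpha> i))"
    using assms(3) by (simp add: reflection_self linear_neg[OF linear_word_prod])
  then show ?thesis using weyl_length_reflection_less[of i "i # p"] i p by simp
qed

lemma reduced_rev:
  assumes "reduced p"
  shows "reduced (rev p)"
proof -
  have p: "set p \<subseteq> {1..n}" "length p = L (wp p)" using assms by (auto simp: reduced_word_def)
  obtain q where q: "reduced q" "wp q = wp (rev p)"
    using exists_reduced[of "wp (rev p)"] word_prod_in_parabolic[of "rev p" n] p(1) by auto
  then have "wp (rev q) = wp p" using word_prod_rev_eqI by fastforce
  then have "L (wp p) \<le> length q" using q weyl_length_le[of "rev q"] by (simp add: reduced_word_def)
  then show ?thesis using p q weyl_length_le[of "rev p"] by (auto simp: reduced_word_def)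
qed

text \<open>A shorter word for the suffix would shorten the whole word.\<close>

lemma reduced_appendD2:
  assumes "reduced (p @ q)"
  shows "reduced q"
proof -
  have pq: "set p \<subseteq> {1..n}" "set q \<subseteq> {1..n}" "length (p @ q) = L (wp (p @ q))"
    using assms by (auto simp: reduced_word_def)
  obtain r where r: "reduced r" "wp r = wp q"
    using exists_reduced[of "wp q"] word_prod_in_parabolic[of q n] pq(2) by auto
  then have "L (wp (p @ q)) \<le> length (p @ r)"
    using weyl_length_le[of "p @ r"] pq by (simp add: reduced_word_def)
  then show ?thesis using pq r weyl_length_le[of q] by (auto simp: reduced_word_def)
qed

lemma reduced_appendD1: "reduced (p @ q) \<Longrightarrow> reduced p"
  by (metis reduced_appendD2 reduced_rev rev_append rev_rev_ident)

text \<open>If the root stayed positive, multiplying by \<open>s i\<close> would lengthen the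
  element, although it merely removes the first letter.\<close>

lemma reduced_Cons_neg:
  assumes "reduced (i # p)"
  shows "pos (- wp (rev (i # p)) (\<alpha> i))"
proof (rule ccontr)
  assume neg: "\<not> ?thesis"
  have i: "i \<in> {1..n}" and p: "set p \<subseteq> {1..n}" using assms by (auto simp: reduced_word_def)
  have "wp (rev (i # p)) (\<alpha> i) \<in> \<Phi>"
    by (rule word_prod_in_roots) (use i p simple_in_roots in auto)
  with neg have "pos (wp (rev (i # p)) (\<alpha> i))" using root_cases by blast
  then have "L (wp (i # p)) < L (s i \<circ> wp (i # p))"
    using i p by (intro weyl_length_reflection_greater) auto
  also have "\<dots> \<le> length p" using weyl_length_le[OF p] by simp
  finally show False using assms by (simp add: reduced_word_def)
qed

lemma reduced_ConsI:
  assumes "i \<in> {1..n}" and "reduced p" and "pos (wp (rev p) (\<alpha> i))"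
  shows "reduced (i # p)"
  using assms weyl_length_reflection_greater[of i p] weyl_length_le[of "i # p"]
  by (auto simp: reduced_word_def)

lemma reduced_snocI:
  assumes "i \<in> {1..n}" and "reduced p" and "pos (wp p (\<alpha> i))"
  shows "reduced (p @ [i])"
  using reduced_rev[OF reduced_ConsI[OF assms(1) reduced_rev[OF assms(2)]]] assms(3) by simp

lemma reduced_snoc_pos:
  assumes "reduced (p @ [i])"
  shows "pos (wp p (\<alpha> i))"
  using reduced_Cons_neg[of i "rev p"] reduced_rev[OF assms]
  by (simp add: reflection_self linear_neg[OF linear_word_prod])

lemma inner_dual_span_eq_0:
  assumes "j \<le> n" and "x \<in> span (\<alpha> ` {1..j})" and "k \<in> {1..n}" and "k > j"
  shows "dual k \<bullet> x = 0"
  using assms(2)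
proof (induction rule: span_induct_alt)
  case base
  then show ?case by simp
next
  case (step c a y)
  then obtain i where "i \<in> {1..j}" "a = \<alpha> i" by auto
  then have "dual k \<bullet> a = 0" using assms inner_dual[of i k] by auto
  with step show ?case by (simp add: inner_add_right)
qed

text \<open>The inverse of the element sends \<open>\<alpha> i\<close>, for the first letter
  \<open>i\<close>, to a negative root. Words in letters up to \<open>j\<close> leave every
  coordinate beyond \<open>j\<close> unchanged, so for \<open>i > j\<close> that coordinate would
  still be 1. Hence lengths taken in the whole group can be used inside
  \<open>parabolic \<alpha> j\<close>.\<close>

lemma reduced_letters:
  assumes "j \<le> n" and "reduced p" and "wp p \<in> parabolic \<alpha> j"
  shows "set p \<subseteq> {1..j}"
  using assms(2,3)
proof (induction p)
  case Nil
  then show ?case by simp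
next
  case (Cons i p)
  have i: "i \<in> {1..n}" using Cons.prems by (simp add: reduced_word_def)
  obtain q where q: "set q \<subseteq> {1..j}" "wp (i # p) = wp q"
    using Cons.prems(2) unfolding parabolic_eq by blast
  then have rev_eq: "wp (rev (i # p)) = wp (rev q)" using word_prod_rev_eqI by metis
  have "i \<le> j"
  proof (rule ccontr)
    assume "\<not> i \<le> j"
    have fixed: "dual i \<bullet> wp (rev q) x = dual i \<bullet> x" for x
      using q(1)
    proof (induction q arbitrary: x)
      case Nil
      then show ?case by simp
    next
      case (Cons k q)
      have "dual i \<bullet> s k x = dual i \<bullet> x"
        using Cons.prems \<open>\<not> i \<le> j\<close> \<open>j \<le> n\<close> inner_dual[of k i]
        by (auto simp: reflection_def inner_diff_right)
      with Cons show ?case by simp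
    qed
    have "pos (- wp (rev q) (\<alpha> i))" using reduced_Cons_neg[OF Cons.prems(1)] unfolding rev_eq .
    then have "dual i \<bullet> - wp (rev q) (\<alpha> i) \<ge> 0" using i by (auto simp: pos_def)
    then show False using i by (simp add: fixed inner_dual)
  qed
  moreover have "wp p = s i \<circ> wp q" using q(2) by (metis reflection_comp_cancel word_prod_Cons)
  then have "wp p = wp (i # q)" by simp
  then have "wp p \<in> parabolic \<alpha> j" unfolding parabolic_eq using q(1) i \<open>i \<le> j\<close>
    by (auto intro!: exI[of _ "i # q"])
  ultimately show ?case using Cons.IH reduced_appendD2[of "[i]" p] Cons.prems(1) i by auto
qed

text \<open>Exchanges are conditioned on distinct reflections, descents speak of distinct letters;
  this translates between the two.\<close>

lemma reflection_simple_inj: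
  assumes "i \<in> {1..n}" "k \<in> {1..n}" "s i = s k"
  shows "i = k"
proof (rule ccontr)
  assume "i \<noteq> k"
  have "s k (\<alpha> i) = - \<alpha> i" using assms(3) by (metis reflection_self)
  then have "dual i \<bullet> s k (\<alpha> i) = -1" using assms(1) by (simp add: inner_dual)
  then show False using assms \<open>i \<noteq> k\<close> by (simp add: reflection_def inner_diff_right inner_dual)
qed

end
section \<open>Commutation classes of words and initial subgraphs\<close>

text \<open>The word-level counterpart of \<open>exchange_perms\<close>, which forgets which
  position each letter came from. The starting word is a fixed parameter, so induction runs over the
  word that is reached.\<close>

inductive commutation_equiv :: "(nat \<Rightarrow> 'a::euclidean_space) \<Rightarrow> nat list \<Rightarrow> nat list \<Rightarrow> bool"
  for \<alpha> p where
  equiv_refl: "commutation_equiv \<alpha> p p"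
| equiv_swap: "commutation_equiv \<alpha> p (u @ i # k # v) \<Longrightarrow> reflection (\<alpha> i) \<noteq> reflection (\<alpha> k) \<Longrightarrow>
    commuting (\<alpha> i) (\<alpha> k) \<Longrightarrow> commutation_equiv \<alpha> p (u @ k # i # v)"

lemma commuting_sym: "commuting a b \<Longrightarrow> commuting b a"
  by (simp add: commuting_def)

lemma commutation_equiv_trans:
  assumes "commutation_equiv \<alpha> q r" and "commutation_equiv \<alpha> p q"
  shows "commutation_equiv \<alpha> p r"
  using assms by induction (auto intro: commutation_equiv.equiv_swap)

lemma commutation_equiv_sym: "commutation_equiv \<alpha> p q \<Longrightarrow> commutation_equiv \<alpha> q p"
proof (induction rule: commutation_equiv.induct)
  case equiv_refl
  show ?case by (rule commutation_equiv.equiv_refl)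
next
  case (equiv_swap u i k v)
  have "commutation_equiv \<alpha> (u @ k # i # v) (u @ i # k # v)"
    by (rule commutation_equiv.equiv_swap[OF commutation_equiv.equiv_refl])
      (use equiv_swap in \<open>auto intro: commuting_sym\<close>)
  then show ?case using equiv_swap.IH by (rule commutation_equiv_trans[rotated])
qed

lemma commutation_equiv_context:
  "commutation_equiv \<alpha> p q \<Longrightarrow> commutation_equiv \<alpha> (u @ p @ v) (u @ q @ v)"
proof (induction rule: commutation_equiv.induct)
  case equiv_refl
  show ?case by (rule commutation_equiv.equiv_refl)
next
  case (equiv_swap u' i k v')
  then show ?case using commutation_equiv.equiv_swap[of \<alpha> _ "u @ u'" i k "v' @ v"] by simp
qed

lemma commutation_equiv_Cons: "commutation_equiv \<alpha> p q \<Longrightarrow> commutation_equiv \<alpha> (i # p) (i # q)"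
  using commutation_equiv_context[of \<alpha> p q "[i]" "[]"] by simp

lemma commutation_equiv_mset: "commutation_equiv \<alpha> p q \<Longrightarrow> mset p = mset q"
  by (induction rule: commutation_equiv.induct) simp_all

lemma commutation_equiv_word_prod:
  "commutation_equiv \<alpha> p q \<Longrightarrow> word_prod \<alpha> p = word_prod \<alpha> q"
proof (induction rule: commutation_equiv.induct)
  case equiv_refl
  show ?case by simp
next
  case (equiv_swap u i k v)
  have "word_prod \<alpha> (i # k # v) = word_prod \<alpha> (k # i # v)"
    using equiv_swap(3) by (simp add: commuting_def comp_assoc[symmetric])
  with equiv_swap.IH show ?case by (simp only: word_prod_append)
qed

section \<open>Permutations realised by exchanges\<close>

lemma exchange_perms_permutes:
  "\<sigma> \<in> exchange_perms \<alpha> p \<Longrightarrow> \<sigma> permutes {..<length p}"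
proof (induction rule: exchange_perms.induct)
  case id
  show ?case by (rule permutes_id)
next
  case (exchange \<sigma> l)
  then show ?case by (intro permutes_compose[OF permutes_swap_id]) auto
qed

lemma split_adjacent:
  assumes "Suc l < length xs"
  shows "xs = take l xs @ xs ! l # xs ! Suc l # drop (Suc (Suc l)) xs"
  using assms by (simp add: Cons_nth_drop_Suc)

lemma permute_list_adjacent:
  assumes "Suc l < length xs"
  shows "permute_list (Transposition.transpose l (Suc l)) xs =
    take l xs @ xs ! Suc l # xs ! l # drop (Suc (Suc l)) xs"
proof (rule nth_equalityI)
  fix i assume i: "i < length (permute_list (Transposition.transpose l (Suc l)) xs)"
  consider "i < l" | "i = l" | "i = Suc l" | d where "i = Suc (Suc l) + d"
    by (metis less_Suc_eq linorder_not_less le_iff_add)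
  then show "permute_list (Transposition.transpose l (Suc l)) xs ! i =
      (take l xs @ xs ! Suc l # xs ! l # drop (Suc (Suc l)) xs) ! i"
    using i assms
    by cases (simp_all add: permute_list_def nth_append transpose_def)
qed (use assms in simp)

lemma permute_list_exchange:
  assumes "\<sigma> \<in> exchange_perms \<alpha> p" and "Suc l < length p"
  shows "permute_list (\<sigma> \<circ> Transposition.transpose l (Suc l)) p =
    permute_list (Transposition.transpose l (Suc l)) (permute_list \<sigma> p)"
  by (rule permute_list_compose) (use assms in \<open>auto intro: permutes_swap_id\<close>)

lemma commutation_equiv_permute_list:
  assumes "\<sigma> \<in> exchange_perms \<alpha> p"
  shows "commutation_equiv \<alpha> p (permute_list \<sigma> p)"
  using assms
proof induction
  case id
  show ?case by (simp add: commutation_equiv.equiv_refl)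
next
  case (exchange \<sigma> l)
  let ?q = "permute_list \<sigma> p"
  have l: "Suc l < length ?q" using exchange by simp
  have "commutation_equiv \<alpha> p (take l ?q @ ?q ! Suc l # ?q ! l # drop (Suc (Suc l)) ?q)"
    by (rule commutation_equiv.equiv_swap)
      (use exchange split_adjacent[OF l] in \<open>auto simp: permute_list_nth exchange_perms_permutes\<close>)
  then show ?case
    unfolding permute_list_exchange[OF exchange(1,2)] permute_list_adjacent[OF l] .
qed

text \<open>Each swap of neighbouring letters lifts to composition with the transposition of their
  two positions.\<close>

lemma commutation_equiv_imp_permute_list:
  assumes "commutation_equiv \<alpha> p q"
  obtains \<sigma> where "\<sigma> \<in> exchange_perms \<alpha> p" and "q = permute_list \<sigma> p"
proof -
  have "\<exists>\<sigma>\<in>exchange_perms \<alpha> p. q = permute_list \<sigma> p"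
    using assms
  proof induction
    case equiv_refl
    show ?case by (intro bexI[of _ id]) (auto intro: exchange_perms.id)
  next
    case (equiv_swap u i k v)
    then obtain \<sigma> where \<sigma>: "\<sigma> \<in> exchange_perms \<alpha> p" "u @ i # k # v = permute_list \<sigma> p" by blast
    let ?l = "length u"
    have l: "Suc ?l < length p" using arg_cong[OF \<sigma>(2), of length] by simp
    have "p ! \<sigma> ?l = i" "p ! \<sigma> (Suc ?l) = k"
      using l permute_list_nth[OF exchange_perms_permutes[OF \<sigma>(1)], of ?l]
        permute_list_nth[OF exchange_perms_permutes[OF \<sigma>(1)], of "Suc ?l"]
      by (simp_all add: \<sigma>(2)[symmetric] nth_append)
    then have "\<sigma> \<circ> Transposition.transpose ?l (Suc ?l) \<in> exchange_perms \<alpha> p"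
      using exchange_perms.exchange[OF \<sigma>(1) l] equiv_swap by simp
    moreover have "u @ k # i # v = permute_list (\<sigma> \<circ> Transposition.transpose ?l (Suc ?l)) p"
      unfolding permute_list_exchange[OF \<sigma>(1) l] \<sigma>(2)[symmetric]
      by (subst permute_list_adjacent) (simp_all add: nth_append)
    ultimately show ?case by blast
  qed
  with that show thesis by blast
qed

text \<open>Only letters with distinct commuting reflections ever pass each other, so any other pair
  keeps its original order. Here \<open>x\<close> and \<open>y\<close> are places in the rearranged
  word, while \<open>\<sigma> x\<close> and \<open>\<sigma> y\<close> are the original
  positions.\<close>

lemma exchange_perms_order:
  assumes "\<sigma> \<in> exchange_perms \<alpha> p" and "x < y" and "y < length p"
    and "\<not> commuting (\<alpha> (p ! \<sigma> x)) (\<alpha> (p ! \<sigma> y)) \<or>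
      reflection (\<alpha> (p ! \<sigma> x)) = reflection (\<alpha> (p ! \<sigma> y))"
  shows "\<sigma> x < \<sigma> y"
  using assms
proof (induction arbitrary: x y)
  case id
  then show ?case by simp
next
  case (exchange \<sigma> l)
  let ?t = "Transposition.transpose l (Suc l)"
  \<comment> \<open>The pair being exchanged is excluded by the premise on commutation and
    reflections; the transposition preserves the order of every other pair.\<close>
  have "\<not> (x = l \<and> y = Suc l)"
    using exchange by (auto dest: commuting_sym)
  then have "?t x < ?t y" and "?t y < length p"
    using exchange by (auto simp: transpose_def)
  then show ?case using exchange.IH[of "?t x" "?t y"] exchange.prems by simp
qed

lemma exchange_perms_order_iff:
  assumes "\<sigma> \<in> exchange_perms \<alpha> p" and "x < length p" and "y < length p"
    and "\<not> commuting (\<alpha> (p ! \<sigma> x)) (\<alpha> (p ! \<sigma> y)) \<or>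
      reflection (\<alpha> (p ! \<sigma> x)) = reflection (\<alpha> (p ! \<sigma> y))"
  shows "\<sigma> x < \<sigma> y \<longleftrightarrow> x < y"
proof (cases x y rule: linorder_cases)
  case less
  with exchange_perms_order[of \<sigma> \<alpha> p x y] assms show ?thesis by simp
next
  case greater
  have "\<sigma> y < \<sigma> x"
    using exchange_perms_order[OF assms(1) greater assms(2)] assms(4) commuting_sym by metis
  with greater show ?thesis by simp
qed simp

section \<open>Initial subgraphs as prefixes of rearranged words\<close>

lemma permutes_less_iff: "\<sigma> permutes {..<N} \<Longrightarrow> \<sigma> x < N \<longleftrightarrow> x < (N :: nat)"
  using permutes_in_image[of \<sigma> "{..<N}" x] by simp

lemma permutes_less_surj:
  assumes "\<sigma> permutes {..<N}" and "a < (N :: nat)"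
  obtains x where "x < N" and "\<sigma> x = a"
proof -
  have "a \<in> \<sigma> ` {..<N}" using assms by (simp add: permutes_image)
  with that show thesis by auto
qed

lemma initial_subgraphs_iff:
  "T \<in> initial_subgraphs \<alpha> p \<longleftrightarrow>
    pverts T \<subseteq> {..<length p} \<and>
    parcs T = {e \<in> parcs (word_graph \<alpha> p). fst e \<in> pverts T \<and> snd e \<in> pverts T} \<and>
    (pverts T \<noteq> {} \<longrightarrow> 0 \<in> pverts T) \<and>
    (\<forall>a b. b \<in> pverts T \<and> (a, b) \<in> parcs (word_graph \<alpha> p) \<longrightarrow> a \<in> pverts T)"
  by (auto simp: initial_subgraphs_def induced_subgraph_def subgraph_def compatible_def
      wf_digraph_def word_graph_def)

text \<open>A full subgraph is determined by its vertices, so vertex sets suffice from here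
  on.\<close>

lemma initial_subgraphs_eqI:
  assumes "T \<in> initial_subgraphs \<alpha> p" and "U \<in> initial_subgraphs \<alpha> p" and "pverts T = pverts U"
  shows "T = U"
  using assms by (intro pair_pre_digraph.equality) (simp_all add: initial_subgraphs_iff)

lemma word_graph_arcs_less:
  assumes "(a, b) \<in> parcs (word_graph \<alpha> p)"
  shows "a < b" and "\<not> commuting (\<alpha> (p ! a)) (\<alpha> (p ! b))"
proof -
  obtain \<sigma> l where "\<sigma> \<in> exchange_perms \<alpha> p" "Suc l < length p" "\<sigma> l = a" "\<sigma> (Suc l) = b"
    and nc: "\<not> commuting (\<alpha> (p ! a)) (\<alpha> (p ! b))"
    using assms by (auto simp: word_graph_def)
  then show "a < b" using exchange_perms_order[of \<sigma> \<alpha> p l "Suc l"] by auto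
  show "\<not> commuting (\<alpha> (p ! a)) (\<alpha> (p ! b))" by (fact nc)
qed

text \<open>The ends of an arc do not commute and so keep their order, which puts the source of any
  arc into the prefix inside the prefix. Vertex 0 is in front because its reflection equals that of
  the first letter, so these two letters cannot have changed order either.\<close>

lemma exists_initial_subgraph:
  assumes \<sigma>: "\<sigma> \<in> exchange_perms \<alpha> p" and k: "k \<le> length p"
    and first: "k > 0 \<Longrightarrow> reflection (\<alpha> (p ! \<sigma> 0)) = reflection (\<alpha> (p ! 0))"
  obtains T where "T \<in> initial_subgraphs \<alpha> p" and "pverts T = \<sigma> ` {..<k}"
proof -
  have perm: "\<sigma> permutes {..<length p}" by (rule exchange_perms_permutes[OF \<sigma>])
  let ?V = "\<sigma> ` {..<k}"
  have "?V \<subseteq> {..<length p}" using k by (auto simp: permutes_less_iff[OF perm])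
  moreover have "0 \<in> ?V" if "?V \<noteq> {}"
  proof -
    have "k > 0" using that by auto
    then have "0 < length p" using k by auto
    then obtain x where x: "x < length p" "\<sigma> x = 0" by (rule permutes_less_surj[OF perm])
    then have "\<not> 0 < x" using exchange_perms_order[OF \<sigma>, of 0 x] first[OF \<open>k > 0\<close>] by auto
    then show ?thesis using x \<open>k > 0\<close> by auto
  qed
  moreover have "a \<in> ?V" if b: "b \<in> ?V" and ab: "(a, b) \<in> parcs (word_graph \<alpha> p)" for a b
  proof -
    obtain y where y: "y < k" "b = \<sigma> y" using b by auto
    have "a < length p" using ab by (simp add: word_graph_def)
    then obtain x where x: "x < length p" "\<sigma> x = a" by (rule permutes_less_surj[OF perm])
    have "x < y"
      using exchange_perms_order_iff[OF \<sigma> x(1), of y] word_graph_arcs_less[OF ab] x y k by auto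
    then show ?thesis using x y by auto
  qed
  ultimately have "\<lparr>pverts = ?V,
      parcs = {e \<in> parcs (word_graph \<alpha> p). fst e \<in> ?V \<and> snd e \<in> ?V}\<rparr> \<in> initial_subgraphs \<alpha> p"
    unfolding initial_subgraphs_iff by simp blast
  then show thesis by (rule that) simp
qed

text \<open>Among all \<open>\<sigma>\<close>, one for which the elements of \<open>T\<close> occupy positions with least
  possible sum puts \<open>T\<close> in front: otherwise some element outside \<open>T\<close> immediately precedes one
  in \<open>T\<close>, they are not joined by an edge, and exchanging them decreases the sum.\<close>

lemma initial_subgraph_prefix:
  assumes T: "T \<in> initial_subgraphs \<alpha> p"
    and no_repeat: "\<And>\<sigma> l. \<sigma> \<in> exchange_perms \<alpha> p \<Longrightarrow> Suc l < length p \<Longrightarrow>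
      reflection (\<alpha> (p ! \<sigma> l)) \<noteq> reflection (\<alpha> (p ! \<sigma> (Suc l)))"
  obtains \<sigma> k where "\<sigma> \<in> exchange_perms \<alpha> p" and "k \<le> length p" and "pverts T = \<sigma> ` {..<k}"
proof -
  define A where "A \<sigma> = {l. l < length p \<and> \<sigma> l \<in> pverts T}" for \<sigma> :: "nat \<Rightarrow> nat"
  have fin: "finite (A \<sigma>)" for \<sigma> by (simp add: A_def)
  obtain \<sigma> where \<sigma>: "\<sigma> \<in> exchange_perms \<alpha> p"
    and min: "\<And>\<sigma>'. \<sigma>' \<in> exchange_perms \<alpha> p \<Longrightarrow> \<Sum> (A \<sigma>) \<le> \<Sum> (A \<sigma>')"
    using ex_has_least_nat[of "\<lambda>\<sigma>. \<sigma> \<in> exchange_perms \<alpha> p" id "\<lambda>\<sigma>. \<Sum> (A \<sigma>)"]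
      exchange_perms.id by blast
  have perm: "\<sigma> permutes {..<length p}" by (rule exchange_perms_permutes[OF \<sigma>])
  have down: "l \<in> A \<sigma>" if l: "Suc l \<in> A \<sigma>" for l
  proof (rule ccontr)
    assume nl: "l \<notin> A \<sigma>"
    let ?\<sigma> = "\<sigma> \<circ> Transposition.transpose l (Suc l)"
    have len: "Suc l < length p" and in_T: "\<sigma> (Suc l) \<in> pverts T" "\<sigma> l \<notin> pverts T"
      using l nl by (auto simp: A_def)
    have "\<sigma> l < length p" "\<sigma> (Suc l) < length p"
      using len by (auto simp: permutes_less_iff[OF perm])
    moreover have "(\<sigma> l, \<sigma> (Suc l)) \<notin> parcs (word_graph \<alpha> p)"
      using T in_T unfolding initial_subgraphs_iff by blast
    ultimately have "commuting (\<alpha> (p ! \<sigma> l)) (\<alpha> (p ! \<sigma> (Suc l)))"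
      using \<sigma> len unfolding word_graph_def by auto
    then have "?\<sigma> \<in> exchange_perms \<alpha> p"
      by (rule exchange_perms.exchange[OF \<sigma> len no_repeat[OF \<sigma> len]])
    moreover have "A ?\<sigma> = insert l (A \<sigma> - {Suc l})"
      using len in_T by (auto simp: A_def transpose_def split: if_splits)
    then have "\<Sum> (A ?\<sigma>) = l + \<Sum> (A \<sigma> - {Suc l})"
      using nl fin by simp
    then have "\<Sum> (A ?\<sigma>) < \<Sum> (A \<sigma>)"
      using sum.remove[OF fin l, of "\<lambda>x. x"] by simp
    ultimately show False using min by (meson leD)
  qed
  define k where "k = (LEAST l. l \<notin> A \<sigma>)"
  have k: "k \<notin> A \<sigma>" unfolding k_def by (rule LeastI[of _ "length p"]) (simp add: A_def)
  have "A \<sigma> = {..<k}"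
  proof (intro equalityI subsetI)
    fix l assume "l \<in> A \<sigma>"
    have "m \<in> A \<sigma>" if "m \<le> l" for m
      using that \<open>l \<in> A \<sigma>\<close> by (induction rule: inc_induct) (auto intro: down)
    with k show "l \<in> {..<k}" by (meson lessThan_iff not_le)
  next
    fix l assume "l \<in> {..<k}"
    then show "l \<in> A \<sigma>" using not_less_Least unfolding k_def by blast
  qed
  moreover have "pverts T = \<sigma> ` A \<sigma>"
  proof -
    have "pverts T \<subseteq> \<sigma> ` {..<length p}"
      using T permutes_image[OF perm] by (simp add: initial_subgraphs_iff)
    then show ?thesis by (auto simp: A_def)
  qed
  moreover have "k \<le> length p" unfolding k_def by (rule Least_le) (simp add: A_def)
  ultimately show thesis using \<sigma> that by simp
qed

text \<open>Equal letters never change order, so a prefix containing \<open>m\<close> copies of a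
  letter contains its first \<open>m\<close> occurrences in \<open>p\<close>. The multiset of
  letters therefore determines the set of positions.\<close>

lemma image_exchange_perms_eqI:
  assumes \<sigma>: "\<sigma> \<in> exchange_perms \<alpha> p" and \<tau>: "\<tau> \<in> exchange_perms \<alpha> p"
    and k: "k \<le> length p" and l: "l \<le> length p"
    and letters: "mset (take k (permute_list \<sigma> p)) = mset (take l (permute_list \<tau> p))"
  shows "\<sigma> ` {..<k} = \<tau> ` {..<l}"
proof -
  have subset: "\<sigma> ` {..<k} \<subseteq> \<tau> ` {..<l}"
    if \<sigma>: "\<sigma> \<in> exchange_perms \<alpha> p" and \<tau>: "\<tau> \<in> exchange_perms \<alpha> p"
      and k: "k \<le> length p" and l: "l \<le> length p"
      and letters: "mset (take k (permute_list \<sigma> p)) = mset (take l (permute_list \<tau> p))"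
    for \<sigma> \<tau> k l
  proof
    fix a assume a: "a \<in> \<sigma> ` {..<k}"
    let ?c = "p ! a"
    have perm: "\<sigma> permutes {..<length p}" "\<tau> permutes {..<length p}"
      using \<sigma> \<tau> exchange_perms_permutes by blast+
    have count: "count (mset (take m (permute_list \<rho> p))) ?c
        = card {b \<in> \<rho> ` {..<m}. p ! b = ?c}"
      if "\<rho> permutes {..<length p}" "m \<le> length p" for \<rho> m
    proof -
      have "take m (permute_list \<rho> p) = map (\<lambda>i. p ! \<rho> i) [0..<m]"
        using that by (simp add: permute_list_def take_map)
      then have "count (mset (take m (permute_list \<rho> p))) ?c = card {i \<in> {..<m}. p ! \<rho> i = ?c}"
        by (auto simp: count_image_mset intro!: arg_cong[of _ _ card])
      also have "\<dots> = card (\<rho> ` {i \<in> {..<m}. p ! \<rho> i = ?c})"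
        by (rule card_image[symmetric]) (meson inj_on_subset permutes_inj subset_UNIV that(1))
      also have "\<rho> ` {i \<in> {..<m}. p ! \<rho> i = ?c} = {b \<in> \<rho> ` {..<m}. p ! b = ?c}" by auto
      finally show ?thesis .
    qed
    have card_eq: "card {b \<in> \<sigma> ` {..<k}. p ! b = ?c} = card {b \<in> \<tau> ` {..<l}. p ! b = ?c}"
      using count[OF perm(1) k] count[OF perm(2) l] letters by simp
    show "a \<in> \<tau> ` {..<l}"
    proof (rule ccontr)
      assume na: "a \<notin> \<tau> ` {..<l}"
      \<comment> \<open>Equal counts turn a position missing on one side into an equal letter
        \<open>b\<close> missing on the other. Then \<open>\<sigma>\<close> forces
        \<open>a < b\<close> and \<open>\<tau>\<close> forces \<open>b < a\<close>.\<close>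
      have "\<exists>b. b \<in> \<tau> ` {..<l} \<and> p ! b = ?c \<and> b \<notin> \<sigma> ` {..<k}"
      proof (rule ccontr)
        assume "\<not> ?thesis"
        then have "{b \<in> \<tau> ` {..<l}. p ! b = ?c} \<subset> {b \<in> \<sigma> ` {..<k}. p ! b = ?c}"
          using a na by auto
        then have "card {b \<in> \<tau> ` {..<l}. p ! b = ?c} < card {b \<in> \<sigma> ` {..<k}. p ! b = ?c}"
          by (intro psubset_card_mono) auto
        with card_eq show False by simp
      qed
      then obtain b where b: "b \<in> \<tau> ` {..<l}" "p ! b = ?c" "b \<notin> \<sigma> ` {..<k}" by blast
      obtain x y where x: "x < k" "\<sigma> x = a" and y: "y < l" "\<tau> y = b" using a b by auto
      have "a < length p" "b < length p"
        using x y k l permutes_less_iff[OF perm(1), of x] permutes_less_iff[OF perm(2), of y]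
        by simp_all
      then obtain x' y' where x': "x' < length p" "\<sigma> x' = b" and y': "y' < length p" "\<tau> y' = a"
        using permutes_less_surj perm by metis
      have "x < x'" using x x' b(3) by (cases "x' < k") auto
      then have "a < b" using exchange_perms_order[OF \<sigma>, of x x'] x x' b(2) by auto
      moreover have "y < y'" using y y' na by (cases "y' < l") auto
      then have "b < a" using exchange_perms_order[OF \<tau>, of y y'] y y' b(2) by auto
      ultimately show False by simp
    qed
  qed
  show ?thesis
    using subset[OF \<sigma> \<tau> k l letters] subset[OF \<tau> \<sigma> l k letters[symmetric]] by blast
qed

section \<open>Descending words\<close>

context based_root_system
begin

text \<open>The letters act from left to right, so the weight reached after \<open>p\<close> is
  \<open>wp (rev p) x\<close>. The inner product has the sign of the pairing, hence each step
  subtracts a positive multiple of a simple root.\<close>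

fun descent :: "nat \<Rightarrow> 'a \<Rightarrow> nat list \<Rightarrow> bool" where
  "descent j x [] \<longleftrightarrow> True"
| "descent j x (i # p) \<longleftrightarrow> i \<in> {1..j} \<and> x \<bullet> \<alpha> i > 0 \<and> descent j (s i x) p"

definition antidominant :: "nat \<Rightarrow> 'a \<Rightarrow> bool" where
  "antidominant j x \<longleftrightarrow> (\<forall>i\<in>{1..j}. x \<bullet> \<alpha> i \<le> 0)"

text \<open>Braidlessness along the orbit under words in \<open>{1..j}\<close>, with inner products
  instead of pairings since only signs and zeros enter.\<close>

definition braidless :: "nat \<Rightarrow> 'a \<Rightarrow> bool" where
  "braidless j x \<longleftrightarrow> (\<forall>p. set p \<subseteq> {1..j} \<longrightarrow> (\<forall>i\<in>{1..j}. \<forall>k\<in>{1..j}.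
     i \<noteq> k \<and> wp p x \<bullet> \<alpha> i > 0 \<and> wp p x \<bullet> \<alpha> k > 0 \<longrightarrow> \<alpha> i \<bullet> \<alpha> k = 0))"

lemma descent_append:
  "descent j x (p @ q) \<longleftrightarrow> descent j x p \<and> descent j (wp (rev p) x) q"
  by (induction p arbitrary: x) auto

lemma descent_letters: "descent j x p \<Longrightarrow> set p \<subseteq> {1..j}"
  by (induction p arbitrary: x) auto

lemma braidlessD:
  assumes "braidless j x" and "i \<in> {1..j}" and "k \<in> {1..j}" and "i \<noteq> k"
    and "x \<bullet> \<alpha> i > 0" and "x \<bullet> \<alpha> k > 0"
  shows "\<alpha> i \<bullet> \<alpha> k = 0"
  using assms unfolding braidless_def by (force dest: spec[of _ "[]"])

lemma braidless_word_prod: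
  assumes "braidless j x" and "set p \<subseteq> {1..j}"
  shows "braidless j (wp p x)"
  unfolding braidless_def
proof (intro allI impI ballI)
  fix q i k
  assume "set q \<subseteq> {1..j}" "i \<in> {1..j}" "k \<in> {1..j}"
    "i \<noteq> k \<and> wp q (wp p x) \<bullet> \<alpha> i > 0 \<and> wp q (wp p x) \<bullet> \<alpha> k > 0"
  then show "\<alpha> i \<bullet> \<alpha> k = 0"
    using assms(1)[unfolded braidless_def, rule_format, of "q @ p" i k] assms(2) by simp
qed

lemma braidless_reflection: "braidless j x \<Longrightarrow> i \<in> {1..j} \<Longrightarrow> braidless j (s i x)"
  using braidless_word_prod[of j x "[i]"] by simp

lemma descent_commute:
  assumes "j \<le> n" and "braidless j x" and "descent j x q"
    and "i \<in> {1..j}" and "x \<bullet> \<alpha> i > 0" and "i \<notin> set q"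
  shows "wp (rev q) x \<bullet> \<alpha> i > 0 \<and> descent j x (i # q) \<and> commutation_equiv \<alpha> (i # q) (q @ [i])"
  using assms(2,3,5,6)
proof (induction q arbitrary: x)
  case Nil
  then show ?case using assms(4) by (auto intro: commutation_equiv.equiv_refl)
next
  case (Cons k q)
  have k: "k \<in> {1..j}" "x \<bullet> \<alpha> k > 0" "i \<noteq> k" using Cons.prems by auto
  have orth: "\<alpha> i \<bullet> \<alpha> k = 0"
    using braidlessD[OF Cons.prems(1) assms(4) k(1)] Cons.prems k by simp
  then have fix_i: "s k (\<alpha> i) = \<alpha> i" and fix_k: "s i (\<alpha> k) = \<alpha> k"
    by (simp_all add: reflection_orthogonal inner_commute)
  have comm: "s i (s k y) = s k (s i y)" for y
    using commuting_orthogonal[OF orth] by (simp add: commuting_def fun_eq_iff)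
  have IH: "wp (rev q) (s k x) \<bullet> \<alpha> i > 0" "descent j (s k x) (i # q)"
      "commutation_equiv \<alpha> (i # q) (q @ [i])"
    using Cons.IH[OF braidless_reflection[OF Cons.prems(1) k(1)]] Cons.prems
    by (auto simp: inner_reflection_left fix_i)
  have "s i \<noteq> s k" using reflection_simple_inj k assms(1,4) by auto
  then have "commutation_equiv \<alpha> (i # k # q) (k # i # q)"
    using commutation_equiv.equiv_swap[OF commutation_equiv.equiv_refl, of \<alpha> i k "[]" q]
      commuting_orthogonal[OF orth] by simp
  moreover have "commutation_equiv \<alpha> (k # i # q) ((k # q) @ [i])"
    using commutation_equiv_Cons[OF IH(3)] by simp
  ultimately have "commutation_equiv \<alpha> (i # k # q) ((k # q) @ [i])"
    by (rule commutation_equiv_trans[rotated])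
  moreover have "descent j x (i # k # q)"
    using IH(2) k Cons.prems assms(4) by (simp add: inner_reflection_left fix_k comm)
  ultimately show ?case using IH(1) by simp
qed

text \<open>\<open>descent_commute\<close> moves the first occurrence of \<open>i\<close> past
  everything before it; the rest of the word starts from the same weight as before.\<close>

lemma descent_pull_front:
  assumes "j \<le> n" and "braidless j x" and "descent j x q"
    and "i \<in> {1..j}" and "x \<bullet> \<alpha> i > 0" and "i \<in> set q"
  obtains q' where "descent j x (i # q')" and "commutation_equiv \<alpha> q (i # q')"
proof -
  obtain q1 q2 where q: "q = q1 @ i # q2" "i \<notin> set q1"
    using split_list_first[OF assms(6)] by blast
  then have d: "descent j x q1" "descent j (wp (rev (q1 @ [i])) x) q2"
    using assms(3) by (simp_all add: descent_append)
  have c: "descent j x (i # q1)" "commutation_equiv \<alpha> (i # q1) (q1 @ [i])"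
    using descent_commute[OF assms(1,2) d(1) assms(4,5) q(2)] by auto
  have "wp (rev (i # q1)) = wp (rev (q1 @ [i]))"
    by (rule word_prod_rev_eqI[OF commutation_equiv_word_prod[OF c(2)]])
  with d(2) have "descent j (wp (rev (i # q1)) x) q2" by (simp only:)
  then have "descent j x ((i # q1) @ q2)" using c(1) by (simp only: descent_append)
  moreover have "commutation_equiv \<alpha> (q1 @ i # q2) (i # q1 @ q2)"
    using commutation_equiv_context[OF commutation_equiv_sym[OF c(2)], of "[]" q2] by simp
  ultimately show thesis using that[of "q1 @ q2"] q(1) by simp
qed

text \<open>The first letter of \<open>p\<close> is available at \<open>x\<close> and occurs in
  \<open>q\<close>, so it can be pulled to the front of \<open>q\<close>. Removing it on both sides
  leaves two descents from the reflected weight.\<close>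

lemma descent_commutation_equiv_mset:
  assumes "j \<le> n" and "braidless j x" and "descent j x p" and "descent j x q"
    and "mset p = mset q"
  shows "commutation_equiv \<alpha> p q"
  using assms(2-)
proof (induction p arbitrary: x q)
  case Nil
  then show ?case by (simp add: commutation_equiv.equiv_refl)
next
  case (Cons i p)
  have i: "i \<in> {1..j}" "x \<bullet> \<alpha> i > 0" using Cons.prems by auto
  have "i \<in> set q" using Cons.prems(4) by (metis list.set_intros(1) set_mset_mset)
  then obtain q' where q': "descent j x (i # q')" "commutation_equiv \<alpha> q (i # q')"
    using descent_pull_front[OF assms(1) Cons.prems(1,3) i] by blast
  have "mset p = mset q'" using commutation_equiv_mset[OF q'(2)] Cons.prems(4) by simp
  then have "commutation_equiv \<alpha> p q'"
    using Cons.IH[OF braidless_reflection[OF Cons.prems(1) i(1)]] Cons.prems(2) q'(1) by simp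
  then show ?case
    by (rule commutation_equiv_trans[OF commutation_equiv_sym[OF q'(2)] commutation_equiv_Cons])
qed

lemma descent_commutation_equiv_antidominant:
  assumes "j \<le> n" and "braidless j x" and "descent j x p" and "descent j x q"
    and "antidominant j (wp (rev p) x)" and "antidominant j (wp (rev q) x)"
  shows "commutation_equiv \<alpha> p q"
  using assms(2-)
proof (induction p arbitrary: x q)
  case Nil
  then have "q = []" by (cases q) (force simp: antidominant_def)+
  then show ?case by (simp add: commutation_equiv.equiv_refl)
next
  case (Cons i p)
  have i: "i \<in> {1..j}" "x \<bullet> \<alpha> i > 0" using Cons.prems by auto
  have "i \<in> set q"
  proof (rule ccontr)
    assume "i \<notin> set q"
    then have "wp (rev q) x \<bullet> \<alpha> i > 0"
      using descent_commute[OF assms(1) Cons.prems(1,3) i] by blast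
    with Cons.prems(5) i(1) show False by (force simp: antidominant_def)
  qed
  then obtain q' where q': "descent j x (i # q')" "commutation_equiv \<alpha> q (i # q')"
    using descent_pull_front[OF assms(1) Cons.prems(1,3) i] by blast
  have "wp (rev q) = wp (rev (i # q'))"
    by (rule word_prod_rev_eqI[OF commutation_equiv_word_prod[OF q'(2)]])
  with Cons.prems(5) have "antidominant j (wp (rev q') (s i x))" by simp
  then have "commutation_equiv \<alpha> p q'"
    using Cons.IH[OF braidless_reflection[OF Cons.prems(1) i(1)]] Cons.prems(2,4) q'(1) by simp
  then show ?case
    by (rule commutation_equiv_trans[OF commutation_equiv_sym[OF q'(2)] commutation_equiv_Cons])
qed

text \<open>A termination measure for descents. The map \<open>s i\<close> is injective and takes
  the roots counted on the left to roots counted on the right, never hitting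
  \<open>\<alpha> i\<close>, which is counted on the right.\<close>

lemma card_pos_inner_less:
  assumes i: "i \<in> {1..n}" and x: "x \<bullet> \<alpha> i > 0"
  shows "card {\<beta>. pos \<beta> \<and> s i x \<bullet> \<beta> > 0} < card {\<beta>. pos \<beta> \<and> x \<bullet> \<beta> > 0}"
proof -
  let ?A = "{\<beta>. pos \<beta> \<and> s i x \<bullet> \<beta> > 0}" and ?B = "{\<beta>. pos \<beta> \<and> x \<bullet> \<beta> > 0}"
  have "finite ?B"
    by (rule finite_subset[of _ \<Phi>]) (use root_system in \<open>auto simp: pos_def root_system_def\<close>)
  have "s i ` ?A \<subseteq> ?B - {\<alpha> i}"
  proof
    fix \<gamma> assume "\<gamma> \<in> s i ` ?A"
    then obtain \<beta> where \<beta>: "pos \<beta>" "x \<bullet> s i \<beta> > 0" "\<gamma> = s i \<beta>"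
      by (auto simp: inner_reflection_left)
    have "\<beta> \<noteq> \<alpha> i" using \<beta> x by (auto simp: reflection_self)
    moreover have "s i \<beta> \<noteq> \<alpha> i"
    proof
      assume "s i \<beta> = \<alpha> i"
      then have "\<beta> = - \<alpha> i" using reflection_reflection[of "\<alpha> i" \<beta>] by (simp add: reflection_self)
      then show False using \<beta>(1) not_pos_uminus[OF pos_simple[OF i]] by simp
    qed
    ultimately show "\<gamma> \<in> ?B - {\<alpha> i}" using reflection_pos[OF \<beta>(1) i] \<beta> by simp
  qed
  then have "card (s i ` ?A) \<le> card (?B - {\<alpha> i})" using \<open>finite ?B\<close> by (simp add: card_mono)
  moreover have "card (s i ` ?A) = card ?A"
    by (rule card_image) (rule inj_on_inverseI[of _ "s i"], simp)
  moreover have "card (?B - {\<alpha> i}) < card ?B"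
    using \<open>finite ?B\<close> x pos_simple[OF i] by (intro card_Diff1_less) auto
  ultimately show ?thesis by simp
qed

lemma exists_descent_antidominant:
  assumes "j \<le> n"
  obtains r where "descent j x r" and "antidominant j (wp (rev r) x)"
proof -
  have "\<exists>r. descent j x r \<and> antidominant j (wp (rev r) x)"
  proof (induction x rule: measure_induct_rule[of "\<lambda>x. card {\<beta>. pos \<beta> \<and> x \<bullet> \<beta> > 0}"])
    case (less x)
    show ?case
    proof (cases "antidominant j x")
      case True
      then show ?thesis by (intro exI[of _ "[]"]) simp
    next
      case False
      then obtain i where i: "i \<in> {1..j}" "x \<bullet> \<alpha> i > 0" by (auto simp: antidominant_def not_le)
      then obtain r where "descent j (s i x) r" "antidominant j (wp (rev r) (s i x))"
        using less[OF card_pos_inner_less, of i] assms by auto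
      with i show ?thesis by (intro exI[of _ "i # r"]) simp
    qed
  qed
  with that show thesis by blast
qed

end
section \<open>The Weyl group and minimal coset representatives\<close>

lemma reflection_group_mono: "X \<subseteq> Y \<Longrightarrow> reflection_group X \<subseteq> reflection_group Y"
  unfolding reflection_group_def by (intro group.mono_generate[OF group_BijGroup] image_mono)

context based_root_system
begin

text \<open>A counterexample \<open>\<gamma>\<close> of least height has positive inner product with
  some simple root \<open>\<alpha> i\<close>. Then \<open>s i \<gamma>\<close> is a lower positive
  root, and the reflection in \<open>\<gamma>\<close> is conjugate to the one in
  \<open>s i \<gamma>\<close> by \<open>s i\<close>.\<close>

lemma pos_reflection_in_parabolic:
  assumes "pos \<beta>"
  shows "reflection \<beta> \<in> parabolic \<alpha> n"
proof (rule ccontr)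
  assume bad: "reflection \<beta> \<notin> parabolic \<alpha> n"
  \<comment> \<open>Inner product with \<open>h\<close> is the height, the sum of the coordinates in
    the simple roots.\<close>
  define h where "h = (\<Sum>i\<in>{1..n}. dual i)"
  have h: "h \<bullet> \<alpha> k = 1" if "k \<in> {1..n}" for k
    using that by (simp add: h_def inner_sum_left inner_dual)
  define B where "B = {\<beta>. pos \<beta> \<and> reflection \<beta> \<notin> parabolic \<alpha> n}"
  have "finite B"
    by (rule finite_subset[of _ \<Phi>]) (use root_system in \<open>auto simp: B_def pos_def root_system_def\<close>)
  moreover have "B \<noteq> {}" using assms bad by (auto simp: B_def)
  ultimately obtain \<gamma> where \<gamma>: "\<gamma> \<in> B" and min: "\<And>\<delta>. \<delta> \<in> B \<Longrightarrow> h \<bullet> \<gamma> \<le> h \<bullet> \<delta>"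
    using arg_min_least[where f = "\<lambda>x. h \<bullet> x"] arg_min_if_finite(1)[where f = "\<lambda>x. h \<bullet> x"] by blast
  have pos: "pos \<gamma>" and root: "\<gamma> \<in> \<Phi>" using \<gamma> by (auto simp: B_def pos_def)
  have "\<exists>i\<in>{1..n}. \<gamma> \<bullet> \<alpha> i > 0"
  proof (rule ccontr)
    assume neg: "\<not> ?thesis"
    have "\<gamma> \<bullet> \<gamma> = \<gamma> \<bullet> (\<Sum>i\<in>{1..n}. (dual i \<bullet> \<gamma>) *\<^sub>R \<alpha> i)"
      using root_expansion[OF root] by simp
    also have "\<dots> = (\<Sum>i\<in>{1..n}. (dual i \<bullet> \<gamma>) * (\<gamma> \<bullet> \<alpha> i))"
      by (simp add: inner_sum_right)
    also have "\<dots> \<le> 0"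
      using pos neg by (intro sum_nonpos mult_nonneg_nonpos) (auto simp: pos_def not_less)
    finally have "\<gamma> \<bullet> \<gamma> \<le> 0" .
    moreover have "\<gamma> \<bullet> \<gamma> > 0" using roots_nonzero[OF root] by simp
    ultimately show False by linarith
  qed
  then obtain i where i: "i \<in> {1..n}" "\<gamma> \<bullet> \<alpha> i > 0" by blast
  have simple: "s i \<in> parabolic \<alpha> n" using word_prod_in_parabolic[of "[i]" n] i(1) by simp
  then have "\<gamma> \<noteq> \<alpha> i" using \<gamma> by (auto simp: B_def)
  then have "pos (s i \<gamma>)" using reflection_pos pos i(1) by blast
  moreover have "h \<bullet> s i \<gamma> < h \<bullet> \<gamma>"
    using i pairing_pos_iff[of \<gamma> "\<alpha> i"] by (simp add: reflection_def inner_diff_right h)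
  ultimately have "reflection (s i \<gamma>) \<in> parabolic \<alpha> n" using min[of "s i \<gamma>"] by (force simp: B_def)
  then have "s i \<circ> (reflection (s i \<gamma>) \<circ> s i) \<in> parabolic \<alpha> n"
    by (intro parabolic_comp simple)
  moreover have "reflection (s i \<gamma>) \<circ> s i = s i \<circ> reflection \<gamma>"
    by (rule reflection_conj[OF linear_reflection inner_reflection])
  ultimately have "reflection \<gamma> \<in> parabolic \<alpha> n" by (simp only: reflection_comp_cancel)
  with \<gamma> show False by (simp add: B_def)
qed

lemma weyl_group_eq_parabolic: "weyl_group \<Phi> = parabolic \<alpha> n"
proof
  have "reflection \<beta> \<in> parabolic \<alpha> n" if "\<beta> \<in> \<Phi>" for \<beta>
    using root_cases[OF that] pos_reflection_in_parabolic reflection_uminus by metis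
  then have "reflection ` \<Phi> \<subseteq> parabolic \<alpha> n" by blast
  moreover have "subgroup (parabolic \<alpha> n) (BijGroup UNIV)"
    unfolding parabolic_def reflection_group_def
    by (rule group.generate_is_subgroup[OF group_BijGroup])
      (auto simp: BijGroup_def Bij_def intro!: bij_reflection)
  ultimately show "weyl_group \<Phi> \<subseteq> parabolic \<alpha> n"
    unfolding weyl_group_def reflection_group_def
    by (rule group.generate_subgroup_incl[OF group_BijGroup])
  show "parabolic \<alpha> n \<subseteq> weyl_group \<Phi>"
    unfolding weyl_group_def parabolic_def
    by (rule reflection_group_mono) (auto intro: simple_in_roots)
qed

lemma exists_min_coset_rep:
  assumes "w \<in> parabolic \<alpha> j"
  obtains v where "v \<in> parabolic \<alpha> (j - 1)" and "v \<circ> w \<in> min_coset_reps n \<alpha> j"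
proof -
  have "id \<in> parabolic \<alpha> (j - 1)" using word_prod_in_parabolic[of "[]"] by simp
  then obtain v where v: "v \<in> parabolic \<alpha> (j - 1)"
    and min: "\<And>u. u \<in> parabolic \<alpha> (j - 1) \<Longrightarrow> L (v \<circ> w) \<le> L (u \<circ> w)"
    using ex_has_least_nat[of "\<lambda>v. v \<in> parabolic \<alpha> (j - 1)" id "\<lambda>v. L (v \<circ> w)"] by blast
  have "v \<in> parabolic \<alpha> j" using v parabolic_mono[of "j - 1" j] by auto
  then have "v \<circ> w \<in> parabolic \<alpha> j" using assms parabolic_comp by blast
  moreover have "L (v \<circ> w) \<le> L (u \<circ> (v \<circ> w))" if "u \<in> parabolic \<alpha> (j - 1)" for u
    using min[OF parabolic_comp[OF that v]] by (simp only: comp_assoc)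
  ultimately have "v \<circ> w \<in> min_coset_reps n \<alpha> j" by (simp add: min_coset_reps_def)
  with v that show thesis by blast
qed

text \<open>Otherwise \<open>s k\<close>, which lies in the smaller parabolic, would produce a
  shorter element of the same coset.\<close>

lemma min_coset_rep_pos:
  assumes "j \<le> n" and "set p \<subseteq> {1..n}" and "wp p \<in> min_coset_reps n \<alpha> j"
    and "k \<in> {1..j - 1}"
  shows "pos (wp (rev p) (\<alpha> k))"
proof (rule ccontr)
  assume "\<not> ?thesis"
  moreover have k: "k \<in> {1..n}" using assms by auto
  moreover have "wp (rev p) (\<alpha> k) \<in> \<Phi>"
    using assms(2) simple_in_roots[OF k] by (intro word_prod_in_roots) auto
  ultimately have "L (s k \<circ> wp p) < L (wp p)"
    using weyl_length_reflection_less[OF k assms(2)] root_cases by blast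
  moreover have "s k \<in> parabolic \<alpha> (j - 1)"
    using word_prod_in_parabolic[of "[k]" "j - 1"] assms(4) by simp
  ultimately show False using assms(3) unfolding min_coset_reps_def by (auto simp: not_less[symmetric])
qed

end

text \<open>Only the sign of \<open>\<omega>\<close> on the simple roots \<open>\<alpha> 1, \<dots>, \<alpha> j\<close> matters, so that \<open>\<omega>\<close> need not be
  normalised.\<close>

locale braidless_level = based_root_system +
  fixes j :: nat and \<omega> :: 'a
  assumes j: "j \<in> {1..n}"
    and omega_orthogonal: "\<And>k. k \<in> {1..j - 1} \<Longrightarrow> \<omega> \<bullet> \<alpha> k = 0"
    and omega_pos: "\<omega> \<bullet> \<alpha> j > 0"
    and braidless_omega: "braidless j \<omega>"
begin

abbreviation reps :: "('a \<Rightarrow> 'a) set" where "reps \<equiv> min_coset_reps n \<alpha> j"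

lemma j_le: "j \<le> n"
  using j by simp

text \<open>\<open>\<omega>\<close> vanishes on the simple roots before \<open>j\<close>, and
  \<open>\<beta>\<close> has no coordinates beyond \<open>j\<close>. So the sign of
  \<open>\<omega>\<close> on a root of level \<open>j\<close> is the sign of its coordinate at
  \<open>j\<close>.\<close>

lemma inner_omega:
  assumes "\<beta> \<in> \<Phi>" and "\<beta> \<in> span (\<alpha> ` {1..j})"
  shows "\<omega> \<bullet> \<beta> = (dual j \<bullet> \<beta>) * (\<omega> \<bullet> \<alpha> j)"
proof -
  have "\<omega> \<bullet> \<beta> = \<omega> \<bullet> (\<Sum>i\<in>{1..n}. (dual i \<bullet> \<beta>) *\<^sub>R \<alpha> i)"
    using root_expansion[OF assms(1)] by simp
  also have "\<dots> = (\<Sum>i\<in>{1..n}. (dual i \<bullet> \<beta>) * (\<omega> \<bullet> \<alpha> i))"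
    by (simp add: inner_sum_right)
  also have "\<dots> = (\<Sum>i\<in>{1..n}. if i = j then (dual j \<bullet> \<beta>) * (\<omega> \<bullet> \<alpha> j) else 0)"
  proof (rule sum.cong[OF refl])
    fix i assume i: "i \<in> {1..n}"
    consider "i \<in> {1..j - 1}" | "i = j" | "i > j" using i by force
    then show "(dual i \<bullet> \<beta>) * (\<omega> \<bullet> \<alpha> i) = (if i = j then (dual j \<bullet> \<beta>) * (\<omega> \<bullet> \<alpha> j) else 0)"
    proof cases
      case 1
      then show ?thesis using omega_orthogonal[OF 1] by auto
    next
      case 3
      then show ?thesis using inner_dual_span_eq_0[OF j_le assms(2) i] by simp
    qed simp
  qed
  finally show ?thesis using j by simp
qed

lemma word_prod_simple_root:
  assumes "set p \<subseteq> {1..j}" and "i \<in> {1..j}"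
  shows "wp p (\<alpha> i) \<in> \<Phi>" and "wp p (\<alpha> i) \<in> span (\<alpha> ` {1..j})"
proof -
  show "wp p (\<alpha> i) \<in> \<Phi>"
    by (intro word_prod_in_roots simple_in_roots) (use assms j_le in auto)
  show "wp p (\<alpha> i) \<in> span (\<alpha> ` {1..j})"
    by (rule word_prod_span[OF assms(1)]) (use assms(2) in \<open>blast intro: span_base\<close>)
qed

text \<open>A descending letter \<open>i\<close> after \<open>p\<close> means that
  \<open>\<omega>\<close> is positive on \<open>wp p (\<alpha> i)\<close>. That root then has a
  positive coordinate at \<open>j\<close>, hence is positive, and appending \<open>i\<close> keeps
  the word reduced.\<close>

lemma descent_imp_reduced: "descent j \<omega> p \<Longrightarrow> reduced p"
proof (induction p rule: rev_induct)
  case Nil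
  then show ?case using weyl_length_le[of "[]"] by (simp add: reduced_word_def)
next
  case (snoc i p)
  then have p: "descent j \<omega> p" "reduced p" and i: "i \<in> {1..j}" "wp (rev p) \<omega> \<bullet> \<alpha> i > 0"
    by (auto simp: descent_append)
  note root = word_prod_simple_root[OF descent_letters[OF p(1)] i(1)]
  have "0 < (dual j \<bullet> wp p (\<alpha> i)) * (\<omega> \<bullet> \<alpha> j)"
    using i(2) inner_omega[OF root] by (simp add: inner_word_prod_rev)
  then have "dual j \<bullet> wp p (\<alpha> i) > 0" using omega_pos by (simp add: zero_less_mult_iff)
  then have "\<not> pos (- wp p (\<alpha> i))" using j by (force simp: pos_def)
  then have "pos (wp p (\<alpha> i))" using root_cases[OF root(1)] by blast
  then show ?case using i(1) j_le p(2) by (intro reduced_snocI) auto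
qed

text \<open>For \<open>p = u @ i # v\<close> the root \<open>\<beta> = wp u (\<alpha> i)\<close> is
  positive, and the inverse of \<open>wp p\<close> makes it negative. Without a coordinate at
  \<open>j\<close> it would be a combination of simple roots before \<open>j\<close>, which that
  inverse keeps positive by minimality. So its coordinate at \<open>j\<close> is positive, and so is
  \<open>\<omega> \<bullet> \<beta>\<close>.\<close>

lemma reduced_min_coset_rep_descent:
  assumes "reduced p" and "wp p \<in> reps"
  shows "descent j \<omega> p"
proof -
  have p: "set p \<subseteq> {1..j}"
    by (rule reduced_letters[OF j_le assms(1)]) (use assms(2) in \<open>simp add: min_coset_reps_def\<close>)
  \<comment> \<open>Minimality is assumed of the whole word only, so the induction runs over the
    prefixes of a fixed \<open>p\<close>.\<close>
  have "descent j \<omega> u" if "p = u @ v" for u v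
    using that
  proof (induction u arbitrary: v rule: rev_induct)
    case Nil
    show ?case by simp
  next
    case (snoc i u)
    then have p_eq: "p = u @ i # v" and IH: "descent j \<omega> u" by auto
    have letters: "set u \<subseteq> {1..j}" "i \<in> {1..j}" using p p_eq by auto
    define \<beta> where "\<beta> = wp u (\<alpha> i)"
    have \<beta>: "\<beta> \<in> \<Phi>" "\<beta> \<in> span (\<alpha> ` {1..j})"
      using word_prod_simple_root[OF letters] by (simp_all add: \<beta>_def)
    have "reduced (u @ [i])" using assms(1) p_eq reduced_appendD1[of "u @ [i]" v] by simp
    then have pos: "pos \<beta>" unfolding \<beta>_def by (rule reduced_snoc_pos)
    \<comment> \<open>The prefix \<open>u\<close> cancels against its inverse, leaving the effect of
      the reduced word \<open>i # v\<close> on \<open>\<alpha> i\<close>.\<close>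
    have neg: "pos (- wp (rev p) \<beta>)"
      using reduced_Cons_neg[of i v] reduced_appendD2[of u "i # v"] assms(1)
      by (simp add: p_eq \<beta>_def)
    have "dual j \<bullet> \<beta> \<noteq> 0"
    proof
      assume zero: "dual j \<bullet> \<beta> = 0"
      have "wp (rev p) \<beta> = wp (rev p) (\<Sum>k\<in>{1..n}. (dual k \<bullet> \<beta>) *\<^sub>R \<alpha> k)"
        using root_expansion[OF \<beta>(1)] by simp
      also have "\<dots> = (\<Sum>k\<in>{1..n}. (dual k \<bullet> \<beta>) *\<^sub>R wp (rev p) (\<alpha> k))"
        by (simp add: linear_sum[OF linear_word_prod] linear_scale[OF linear_word_prod])
      finally have eq: "wp (rev p) \<beta> = (\<Sum>k\<in>{1..n}. (dual k \<bullet> \<beta>) *\<^sub>R wp (rev p) (\<alpha> k))" .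
      \<comment> \<open>Every summand is nonnegative: by minimality for \<open>k < j\<close>, by
        \<open>zero\<close> for \<open>k = j\<close>, and because the coordinate vanishes for
        \<open>k > j\<close>.\<close>
      have "dual i \<bullet> wp (rev p) \<beta> \<ge> 0" if i: "i \<in> {1..n}" for i
      proof -
        have "0 \<le> (dual k \<bullet> \<beta>) * (dual i \<bullet> wp (rev p) (\<alpha> k))" if k: "k \<in> {1..n}" for k
        proof -
          consider "k \<in> {1..j - 1}" | "k = j" | "k > j" using k by force
          then show ?thesis
          proof cases
            case 1
            then have "pos (wp (rev p) (\<alpha> k))"
              using assms(2) p j_le by (intro min_coset_rep_pos[of j]) auto
            then show ?thesis using pos i k by (simp add: pos_def)
          next
            case 3
            then show ?thesis using inner_dual_span_eq_0[OF j_le \<beta>(2) k] by simp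
          qed (simp add: zero)
        qed
        then show ?thesis unfolding eq inner_sum_right by (intro sum_nonneg) simp
      qed
      moreover have "wp (rev p) \<beta> \<in> \<Phi>"
        using \<beta>(1) p j_le by (intro word_prod_in_roots) auto
      ultimately have "pos (wp (rev p) \<beta>)" by (simp add: pos_def)
      with neg not_pos_uminus show False by blast
    qed
    then have "dual j \<bullet> \<beta> > 0" using pos j by (force simp: pos_def)
    then have "\<omega> \<bullet> \<beta> > 0" using inner_omega[OF \<beta>] omega_pos by simp
    then have "wp (rev u) \<omega> \<bullet> \<alpha> i > 0" by (simp add: inner_word_prod_rev \<beta>_def)
    then show ?case using IH letters by (simp add: descent_append)
  qed
  then show ?thesis by simp
qed

text \<open>A common continuation \<open>r\<close> down to an antidominant weight makes both words
  equivalent. Hence they have the same letters, \<open>r\<close> cancels from the multisets, and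
  equal letters suffice for equivalence.\<close>

lemma descent_commutation_equiv:
  assumes "descent j \<omega> p" and "descent j \<omega> q" and "wp (rev p) \<omega> = wp (rev q) \<omega>"
  shows "commutation_equiv \<alpha> p q"
proof -
  obtain r where "descent j (wp (rev p) \<omega>) r" "antidominant j (wp (rev r) (wp (rev p) \<omega>))"
    by (rule exists_descent_antidominant[OF j_le])
  then have "commutation_equiv \<alpha> (p @ r) (q @ r)"
    using assms by (intro descent_commutation_equiv_antidominant[OF j_le braidless_omega])
      (auto simp: descent_append)
  then have "mset p = mset q" using commutation_equiv_mset by fastforce
  then show ?thesis
    by (rule descent_commutation_equiv_mset[OF j_le braidless_omega assms(1,2)])
qed

section \<open>Unique factorization through one level\<close>

lemma word_prod_omega: "set q \<subseteq> {1..j - 1} \<Longrightarrow> wp q \<omega> = \<omega>"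
  by (induction q) (auto simp: reflection_orthogonal omega_orthogonal)

lemma min_coset_repE:
  assumes "w \<in> reps"
  obtains p where "reduced p" and "descent j \<omega> p" and "w = wp p"
proof -
  have "w \<in> parabolic \<alpha> n"
    using assms parabolic_mono[OF j_le] by (auto simp: min_coset_reps_def)
  then obtain p where "reduced p" "wp p = w" by (rule exists_reduced)
  with assms that show thesis using reduced_min_coset_rep_descent by blast
qed

text \<open>\<open>parabolic \<alpha> (j - 1)\<close> fixes \<open>\<omega>\<close>, so applying the
  inverses of both sides to \<open>\<omega>\<close> shows that \<open>p\<close> and \<open>q\<close>
  have the same end point. They are then equivalent words, and the remaining factors agree by
  cancellation.\<close>

lemma min_coset_rep_factorization_unique:
  assumes "v \<in> parabolic \<alpha> (j - 1)" and "v' \<in> parabolic \<alpha> (j - 1)"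
    and p: "descent j \<omega> p" and q: "descent j \<omega> q" and eq: "v \<circ> wp p = v' \<circ> wp q"
  shows "v = v'" and "wp p = wp q"
proof -
  obtain a b where a: "set a \<subseteq> {1..j - 1}" "v = wp a" and b: "set b \<subseteq> {1..j - 1}" "v' = wp b"
    using assms(1,2) unfolding parabolic_eq by blast
  have "wp (a @ p) = wp (b @ q)" using eq a b by simp
  then have "wp (rev (a @ p)) \<omega> = wp (rev (b @ q)) \<omega>" using word_prod_rev_eqI by metis
  then have "wp (rev p) \<omega> = wp (rev q) \<omega>"
    using a(1) b(1) by (simp add: word_prod_omega)
  then show wpeq: "wp p = wp q"
    using descent_commutation_equiv[OF p q] commutation_equiv_word_prod by blast
  have "v \<circ> wp p \<circ> wp (rev p) = v' \<circ> wp p \<circ> wp (rev p)" using eq wpeq by simp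
  then show "v = v'" by (simp only: comp_assoc word_prod_rev_cancel comp_id)
qed

text \<open>A minimal representative of the coset of \<open>wp p\<close> has a descending word
  itself, and by uniqueness of the factorization, taken with trivial left factor on its side, it
  equals \<open>wp p\<close>.\<close>

lemma descent_min_coset_rep:
  assumes "descent j \<omega> p"
  shows "wp p \<in> reps"
proof -
  obtain v where v: "v \<in> parabolic \<alpha> (j - 1)" "v \<circ> wp p \<in> reps"
    using exists_min_coset_rep[OF word_prod_in_parabolic[OF descent_letters[OF assms]]] by blast
  obtain q where q: "descent j \<omega> q" "v \<circ> wp p = wp q" by (rule min_coset_repE[OF v(2)])
  have "id \<in> parabolic \<alpha> (j - 1)" using word_prod_in_parabolic[of "[]"] by simp
  then have "wp p = wp q"
    using min_coset_rep_factorization_unique(2)[OF v(1) _ assms q(1)] q(2) by simp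
  with v(2) q(2) show ?thesis by simp
qed

lemma bij_betw_parabolic:
  "bij_betw (\<lambda>(v, w). v \<circ> w) (parabolic \<alpha> (j - 1) \<times> reps) (parabolic \<alpha> j)"
proof (rule bij_betw_imageI)
  show "inj_on (\<lambda>(v, w). v \<circ> w) (parabolic \<alpha> (j - 1) \<times> reps)"
  proof (rule inj_onI, clarify)
    fix v w v' w'
    assume v: "v \<in> parabolic \<alpha> (j - 1)" "v' \<in> parabolic \<alpha> (j - 1)"
      and w: "w \<in> reps" "w' \<in> reps" and eq: "v \<circ> w = v' \<circ> w'"
    obtain p q where "descent j \<omega> p" "w = wp p" "descent j \<omega> q" "w' = wp q"
      using min_coset_repE w by metis
    then show "v = v' \<and> w = w'"
      using min_coset_rep_factorization_unique[OF v] eq by blast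
  qed
  show "(\<lambda>(v, w). v \<circ> w) ` (parabolic \<alpha> (j - 1) \<times> reps) = parabolic \<alpha> j"
  proof (intro equalityI subsetI)
    fix w assume "w \<in> (\<lambda>(v, w). v \<circ> w) ` (parabolic \<alpha> (j - 1) \<times> reps)"
    then show "w \<in> parabolic \<alpha> j"
      using parabolic_mono[of "j - 1" j] by (auto simp: min_coset_reps_def intro!: parabolic_comp)
  next
    fix w assume "w \<in> parabolic \<alpha> j"
    then obtain v where v: "v \<in> parabolic \<alpha> (j - 1)" "v \<circ> w \<in> reps"
      by (rule exists_min_coset_rep)
    obtain v' where v': "v' \<in> parabolic \<alpha> (j - 1)" "v' \<circ> v = id"
      by (rule parabolic_inverse[OF v(1)])
    have "v' \<circ> (v \<circ> w) = w" using v'(2) by (simp only: comp_assoc[symmetric] id_comp)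
    then show "w \<in> (\<lambda>(v, w). v \<circ> w) ` (parabolic \<alpha> (j - 1) \<times> reps)"
      using v(2) v'(1) by (intro image_eqI[of _ _ "(v', v \<circ> w)"]) auto
  qed
qed

end

section \<open>Initial subgraphs and minimal coset representatives\<close>

text \<open>The right-hand side depends on \<open>\<sigma>\<close> and \<open>k\<close> only through
  the set of vertices, which is what makes \<open>tau\<close> independent of the choice.\<close>

lemma mset_take_permute_list:
  assumes "\<sigma> permutes {..<length p}" and "k \<le> length p"
  shows "mset (take k (permute_list \<sigma> p)) = image_mset ((!) p) (mset_set (\<sigma> ` {..<k}))"
proof -
  have "inj_on \<sigma> {..<k}" using permutes_inj[OF assms(1)] by (rule inj_on_subset) simp
  then have "mset_set (\<sigma> ` {..<k}) = image_mset \<sigma> (mset_set {..<k})"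
    by (rule image_mset_mset_set[symmetric])
  moreover have "take k (permute_list \<sigma> p) = map (\<lambda>i. p ! \<sigma> i) [0..<k]"
    using assms(2) by (simp add: permute_list_def take_map)
  ultimately show ?thesis by (simp add: multiset.map_comp lessThan_atLeast0 o_def)
qed

context braidless_level
begin

context
  fixes p :: "nat list"
  assumes longest: "longest_rep_word n \<alpha> j p"
begin

lemma longest_reduced: "reduced p" and longest_in_reps: "wp p \<in> reps"
  using longest by (auto simp: longest_rep_word_def is_arg_max_def)

lemma longest_descent: "descent j \<omega> p"
  by (rule reduced_min_coset_rep_descent[OF longest_reduced longest_in_reps])

text \<open>A letter still available at the end would extend the descent, and with it give a longer
  minimal representative.\<close>

lemma longest_antidominant: "antidominant j (wp (rev p) \<omega>)"
  unfolding antidominant_def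
proof (rule ballI, rule ccontr)
  fix i assume "i \<in> {1..j}" "\<not> wp (rev p) \<omega> \<bullet> \<alpha> i \<le> 0"
  then have d: "descent j \<omega> (p @ [i])" using longest_descent by (simp add: descent_append)
  then have "L (wp (p @ [i])) = Suc (L (wp p))"
    using descent_imp_reduced[OF d] longest_reduced by (simp add: reduced_word_def)
  moreover have "wp (p @ [i]) \<in> reps" by (rule descent_min_coset_rep[OF d])
  ultimately show False
    using longest unfolding longest_rep_word_def is_arg_max_def by (metis lessI)
qed

text \<open>Exchanges change neither the element nor the number of letters, so the result is a
  reduced word of the same minimal representative.\<close>

lemma exchange_descent:
  assumes "\<sigma> \<in> exchange_perms \<alpha> p"
  shows "descent j \<omega> (permute_list \<sigma> p)"
proof (rule reduced_min_coset_rep_descent)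
  note equiv = commutation_equiv_permute_list[OF assms]
  have "set (permute_list \<sigma> p) = set p"
    using commutation_equiv_mset[OF equiv] by (metis set_mset_mset)
  then show "reduced (permute_list \<sigma> p)"
    using longest_reduced commutation_equiv_word_prod[OF equiv] by (simp add: reduced_word_def)
  show "wp (permute_list \<sigma> p) \<in> reps"
    using longest_in_reps commutation_equiv_word_prod[OF equiv] by simp
qed

text \<open>Once \<open>s i\<close> has lowered a weight, the weight is negative on
  \<open>\<alpha> i\<close>, so the same letter cannot follow at once. This is the hypothesis of
  \<open>initial_subgraph_prefix\<close>.\<close>

lemma exchange_no_repeat:
  assumes \<sigma>: "\<sigma> \<in> exchange_perms \<alpha> p" and l: "Suc l < length p"
  shows "s (p ! \<sigma> l) \<noteq> s (p ! \<sigma> (Suc l))"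
proof
  assume eq: "s (p ! \<sigma> l) = s (p ! \<sigma> (Suc l))"
  let ?q = "permute_list \<sigma> p"
  have nth: "?q ! l = p ! \<sigma> l" "?q ! Suc l = p ! \<sigma> (Suc l)"
    using l exchange_perms_permutes[OF \<sigma>] by (simp_all add: permute_list_nth)
  have "?q = take l ?q @ ?q ! l # ?q ! Suc l # drop (Suc (Suc l)) ?q"
    by (rule split_adjacent) (use l in simp)
  with exchange_descent[OF \<sigma>]
  have "descent j \<omega> (take l ?q @ p ! \<sigma> l # p ! \<sigma> (Suc l) # drop (Suc (Suc l)) ?q)"
    unfolding nth by simp
  then have "wp (rev (take l ?q)) \<omega> \<bullet> \<alpha> (p ! \<sigma> l) > 0"
      "s (p ! \<sigma> l) (wp (rev (take l ?q)) \<omega>) \<bullet> \<alpha> (p ! \<sigma> (Suc l)) > 0"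
      "p ! \<sigma> l \<in> {1..j}" "p ! \<sigma> (Suc l) \<in> {1..j}"
    unfolding descent_append by simp_all
  moreover from this have "p ! \<sigma> l = p ! \<sigma> (Suc l)"
    using reflection_simple_inj[OF _ _ eq] j_le by simp
  ultimately show False by (simp add: inner_reflection_left reflection_self)
qed

text \<open>Among the first \<open>j\<close> simple roots, \<open>\<omega>\<close> is positive on
  \<open>\<alpha> j\<close> only. The condition on vertex 0 of an initial subgraph rests on
  this.\<close>

lemma descent_hd:
  assumes "descent j \<omega> q" and "q \<noteq> []"
  shows "q ! 0 = j"
proof -
  obtain i q' where q: "q = i # q'" using assms(2) by (cases q) auto
  then have "i \<in> {1..j}" "\<omega> \<bullet> \<alpha> i > 0" using assms(1) by auto
  then have "i = j" using omega_orthogonal[of i] by force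
  then show ?thesis using q by simp
qed

lemma exchange_first:
  assumes "\<sigma> \<in> exchange_perms \<alpha> p" and "0 < length p"
  shows "p ! \<sigma> 0 = p ! 0"
proof -
  have "permute_list \<sigma> p ! 0 = p ! \<sigma> 0"
    using assms(2) exchange_perms_permutes[OF assms(1)] by (simp add: permute_list_nth)
  moreover have "permute_list \<sigma> p ! 0 = j"
    using assms by (intro descent_hd exchange_descent) (auto simp flip: length_greater_0_conv)
  moreover have "p ! 0 = j" using assms(2) by (intro descent_hd longest_descent) auto
  ultimately show ?thesis by simp
qed

lemma exchange_take_descent:
  assumes "\<sigma> \<in> exchange_perms \<alpha> p"
  shows "descent j \<omega> (take k (permute_list \<sigma> p))"
  using exchange_descent[OF assms] descent_append[of j \<omega> "take k (permute_list \<sigma> p)" "drop k (permute_list \<sigma> p)"]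
  by simp

section \<open>Well-definedness and bijectivity of the map from subgraphs to elements\<close>

lemma representsE:
  assumes "represents \<alpha> p T w"
  obtains \<sigma> k where "\<sigma> \<in> exchange_perms \<alpha> p" and "k \<le> length p" and "pverts T = \<sigma> ` {..<k}"
    and "w = wp (take k (permute_list \<sigma> p))" and "descent j \<omega> (take k (permute_list \<sigma> p))"
  using assms exchange_take_descent unfolding represents_def by blast

text \<open>Two prefixes on the same vertices have the same letters and both descend, so they are
  equivalent words.\<close>

lemma represents_unique:
  assumes "represents \<alpha> p T v" and "represents \<alpha> p T w"
  shows "v = w"
proof -
  from assms(1) obtain \<sigma> k where \<sigma>: "\<sigma> \<in> exchange_perms \<alpha> p" "k \<le> length p"
    "pverts T = \<sigma> ` {..<k}" "v = wp (take k (permute_list \<sigma> p))"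
    "descent j \<omega> (take k (permute_list \<sigma> p))"
    by (rule representsE)
  from assms(2) obtain \<tau> l where \<tau>: "\<tau> \<in> exchange_perms \<alpha> p" "l \<le> length p"
    "pverts T = \<tau> ` {..<l}" "w = wp (take l (permute_list \<tau> p))"
    "descent j \<omega> (take l (permute_list \<tau> p))"
    by (rule representsE)
  have "mset (take k (permute_list \<sigma> p)) = mset (take l (permute_list \<tau> p))"
    using mset_take_permute_list[OF exchange_perms_permutes[OF \<sigma>(1)] \<sigma>(2)]
      mset_take_permute_list[OF exchange_perms_permutes[OF \<tau>(1)] \<tau>(2)] \<sigma>(3) \<tau>(3) by simp
  then have "commutation_equiv \<alpha> (take k (permute_list \<sigma> p)) (take l (permute_list \<tau> p))"
    by (rule descent_commutation_equiv_mset[OF j_le braidless_omega \<sigma>(5) \<tau>(5)])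
  then show ?thesis using \<sigma>(4) \<tau>(4) commutation_equiv_word_prod by blast
qed

lemma exists_represents:
  assumes "T \<in> initial_subgraphs \<alpha> p"
  obtains w where "represents \<alpha> p T w"
  using initial_subgraph_prefix[OF assms exchange_no_repeat] unfolding represents_def by metis

lemma ex1_represents:
  assumes "T \<in> initial_subgraphs \<alpha> p"
  shows "\<exists>!w. represents \<alpha> p T w"
  using exists_represents[OF assms] represents_unique by metis

lemma tau_eqI: "represents \<alpha> p T w \<Longrightarrow> tau \<alpha> p T = w"
  unfolding tau_def using represents_unique by (intro the_equality)

lemma represents_tau: "T \<in> initial_subgraphs \<alpha> p \<Longrightarrow> represents \<alpha> p T (tau \<alpha> p T)"
  using exists_represents tau_eqI by metis

text \<open>Equal elements give descents with equal end points, hence equivalent prefixes with the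
  same letters, and these determine the vertex set.\<close>

lemma initial_subgraphs_eq_if_tau_eq:
  assumes T: "T \<in> initial_subgraphs \<alpha> p" and U: "U \<in> initial_subgraphs \<alpha> p"
    and eq: "tau \<alpha> p T = tau \<alpha> p U"
  shows "T = U"
proof -
  from represents_tau[OF T] obtain \<sigma> k where \<sigma>: "\<sigma> \<in> exchange_perms \<alpha> p" "k \<le> length p"
    "pverts T = \<sigma> ` {..<k}" "tau \<alpha> p T = wp (take k (permute_list \<sigma> p))"
    "descent j \<omega> (take k (permute_list \<sigma> p))"
    by (rule representsE)
  from represents_tau[OF U] obtain \<tau> l where \<tau>: "\<tau> \<in> exchange_perms \<alpha> p" "l \<le> length p"
    "pverts U = \<tau> ` {..<l}" "tau \<alpha> p U = wp (take l (permute_list \<tau> p))"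
    "descent j \<omega> (take l (permute_list \<tau> p))"
    by (rule representsE)
  have "wp (rev (take k (permute_list \<sigma> p))) = wp (rev (take l (permute_list \<tau> p)))"
    by (rule word_prod_rev_eqI) (use \<sigma>(4) \<tau>(4) eq in simp)
  then have "commutation_equiv \<alpha> (take k (permute_list \<sigma> p)) (take l (permute_list \<tau> p))"
    by (intro descent_commutation_equiv[OF \<sigma>(5) \<tau>(5)]) simp
  then have "\<sigma> ` {..<k} = \<tau> ` {..<l}"
    by (intro image_exchange_perms_eqI[OF \<sigma>(1) \<tau>(1) \<sigma>(2) \<tau>(2)] commutation_equiv_mset)
  then show ?thesis using \<sigma>(3) \<tau>(3) by (intro initial_subgraphs_eqI[OF T U]) simp
qed

text \<open>A descending word \<open>q\<close> for \<open>w\<close>, continued by \<open>r\<close>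
  to an antidominant weight, lies in the commutation class of \<open>p\<close>. The positions in
  \<open>p\<close> that make up \<open>q\<close> are the required vertices.\<close>

lemma exists_initial_subgraph_tau:
  assumes "w \<in> reps"
  obtains T where "T \<in> initial_subgraphs \<alpha> p" and "tau \<alpha> p T = w"
proof -
  obtain q where q: "descent j \<omega> q" "w = wp q" by (rule min_coset_repE[OF assms])
  obtain r where r: "descent j (wp (rev q) \<omega>) r" "antidominant j (wp (rev r) (wp (rev q) \<omega>))"
    by (rule exists_descent_antidominant[OF j_le])
  have "commutation_equiv \<alpha> p (q @ r)"
    using q r longest_descent longest_antidominant
    by (intro descent_commutation_equiv_antidominant[OF j_le braidless_omega])
      (auto simp: descent_append)
  then obtain \<sigma> where \<sigma>: "\<sigma> \<in> exchange_perms \<alpha> p" "q @ r = permute_list \<sigma> p"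
    by (rule commutation_equiv_imp_permute_list)
  have len: "length q \<le> length p" using arg_cong[OF \<sigma>(2), of length] by simp
  obtain T where T: "T \<in> initial_subgraphs \<alpha> p" "pverts T = \<sigma> ` {..<length q}"
  proof (rule exists_initial_subgraph[OF \<sigma>(1) len])
    assume "0 < length q"
    then have "0 < length p" using len by linarith
    then show "s (p ! \<sigma> 0) = s (p ! 0)" by (simp only: exchange_first[OF \<sigma>(1)])
  qed
  have "represents \<alpha> p T w"
    unfolding represents_def
    using \<sigma> len T(2) q(2) by (intro bexI[of _ \<sigma>] exI[of _ "length q"]) (simp_all flip: \<sigma>(2))
  then show thesis using that T(1) tau_eqI by blast
qed

lemma bij_betw_tau: "bij_betw (tau \<alpha> p) (initial_subgraphs \<alpha> p) reps"
proof (rule bij_betw_imageI)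
  show "inj_on (tau \<alpha> p) (initial_subgraphs \<alpha> p)"
    by (rule inj_onI) (rule initial_subgraphs_eq_if_tau_eq)
  have "tau \<alpha> p T \<in> reps" if "T \<in> initial_subgraphs \<alpha> p" for T
    using represents_tau[OF that] by (metis representsE descent_min_coset_rep)
  then show "tau \<alpha> p ` initial_subgraphs \<alpha> p = reps"
    by (blast elim: exists_initial_subgraph_tau)
qed

end

end

section \<open>Products of bijections and iterated factorization\<close>

lemma bij_betw_PiE_pointwise:
  assumes "\<And>i. i \<in> I \<Longrightarrow> bij_betw (f i) (A i) (B i)"
  shows "bij_betw (\<lambda>x. \<lambda>i\<in>I. f i (x i)) (\<Pi>\<^sub>E i\<in>I. A i) (\<Pi>\<^sub>E i\<in>I. B i)"
proof (rule bij_betw_byWitness[of _ "\<lambda>y. \<lambda>i\<in>I. inv_into (A i) (f i) (y i)"])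
  show "\<forall>x\<in>\<Pi>\<^sub>E i\<in>I. A i. (\<lambda>i\<in>I. inv_into (A i) (f i) ((\<lambda>i\<in>I. f i (x i)) i)) = x"
  proof (intro ballI ext)
    fix x i assume "x \<in> (\<Pi>\<^sub>E i\<in>I. A i)"
    then show "(\<lambda>i\<in>I. inv_into (A i) (f i) ((\<lambda>i\<in>I. f i (x i)) i)) i = x i"
      using bij_betw_inv_into_left[OF assms]
      by (cases "i \<in> I") (auto simp: PiE_iff extensional_def)
  qed
  show "\<forall>y\<in>\<Pi>\<^sub>E i\<in>I. B i. (\<lambda>i\<in>I. f i ((\<lambda>i\<in>I. inv_into (A i) (f i) (y i)) i)) = y"
  proof (intro ballI ext)
    fix y i assume "y \<in> (\<Pi>\<^sub>E i\<in>I. B i)"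
    then show "(\<lambda>i\<in>I. f i ((\<lambda>i\<in>I. inv_into (A i) (f i) (y i)) i)) i = y i"
      using bij_betw_inv_into_right[OF assms]
      by (cases "i \<in> I") (auto simp: PiE_iff extensional_def)
  qed
  show "(\<lambda>x. \<lambda>i\<in>I. f i (x i)) ` (\<Pi>\<^sub>E i\<in>I. A i) \<subseteq> (\<Pi>\<^sub>E i\<in>I. B i)"
    using bij_betwE[OF assms] by (auto dest: PiE_mem)
  show "(\<lambda>y. \<lambda>i\<in>I. inv_into (A i) (f i) (y i)) ` (\<Pi>\<^sub>E i\<in>I. B i) \<subseteq> (\<Pi>\<^sub>E i\<in>I. A i)"
  proof (clarsimp simp: PiE_iff)
    fix y i assume "\<forall>i\<in>I. y i \<in> B i" "i \<in> I"
    then show "inv_into (A i) (f i) (y i) \<in> A i"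
      using bij_betwE[OF bij_betw_inv_into[OF assms]] by blast
  qed
qed

lemma foldr_comp: "foldr (\<lambda>j u. w j \<circ> u) js u = foldr (\<lambda>j u. w j \<circ> u) js id \<circ> u"
  by (induction js) (simp_all add: comp_assoc)

text \<open>Induction on \<open>m\<close> splits off the rightmost factor: \<open>step\<close>
  handles the last level, and the induction hypothesis factors the remaining element of
  \<open>P m\<close>.\<close>

lemma bij_betw_iterated_factorization:
  assumes step: "\<And>j. j \<in> {1..m} \<Longrightarrow>
      bij_betw (\<lambda>(v, w). v \<circ> w) (P (j - 1) \<times> R j) (P j)"
    and base: "P 0 = {id}"
  shows "bij_betw (\<lambda>w. foldr (\<lambda>j u. w j \<circ> u) [1..<Suc m] id) (\<Pi>\<^sub>E j\<in>{1..m}. R j) (P m)"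
  using step
proof (induction m)
  case 0
  show ?case using base by (simp add: bij_betw_def id_def)
next
  case (Suc m)
  let ?F = "\<lambda>m w. foldr (\<lambda>j u. w j \<circ> u) [1..<Suc m] id"
  let ?A = "\<lambda>m. \<Pi>\<^sub>E j\<in>{1..m}. R j"
  \<comment> \<open>Members of \<open>PiE\<close> are undefined off the index set, so a family on
    \<open>{1..Suc m}\<close> amounts to its restriction to \<open>{1..m}\<close> together with its
    last entry.\<close>
  have split: "bij_betw (\<lambda>w. (restrict w {1..m}, w (Suc m))) (?A (Suc m)) (?A m \<times> R (Suc m))"
  proof (rule bij_betw_byWitness[of _ "\<lambda>(w, a). w(Suc m := a)"])
    show "\<forall>w\<in>?A (Suc m). (\<lambda>(w, a). w(Suc m := a)) (restrict w {1..m}, w (Suc m)) = w"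
      by (auto simp: fun_eq_iff PiE_iff extensional_def)
    show "\<forall>x\<in>?A m \<times> R (Suc m). (restrict ((\<lambda>(w, a). w(Suc m := a)) x) {1..m},
        (\<lambda>(w, a). w(Suc m := a)) x (Suc m)) = x"
      by (auto simp: fun_eq_iff PiE_iff extensional_def)
    show "(\<lambda>w. (restrict w {1..m}, w (Suc m))) ` ?A (Suc m) \<subseteq> ?A m \<times> R (Suc m)"
      by (auto simp: PiE_iff)
    show "(\<lambda>(w, a). w(Suc m := a)) ` (?A m \<times> R (Suc m)) \<subseteq> ?A (Suc m)"
      by (auto simp: PiE_iff extensional_def le_Suc_eq)
  qed
  have "bij_betw (?F m) (?A m) (P m)" by (rule Suc.IH) (use Suc.prems in auto)
  then have product: "bij_betw (map_prod (?F m) id) (?A m \<times> R (Suc m)) (P m \<times> R (Suc m))"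
    by (rule bij_betw_map_prod) simp
  have comp: "bij_betw (\<lambda>(v, w). v \<circ> w) (P m \<times> R (Suc m)) (P (Suc m))"
    by (rule Suc.prems[of "Suc m", unfolded diff_Suc_1]) simp
  have "bij_betw ((\<lambda>(v, w). v \<circ> w) \<circ> (map_prod (?F m) id \<circ>
      (\<lambda>w. (restrict w {1..m}, w (Suc m))))) (?A (Suc m)) (P (Suc m))"
    by (rule bij_betw_trans[OF bij_betw_trans[OF split product] comp])
  moreover have "?F m (restrict w {1..m}) \<circ> w (Suc m) = ?F (Suc m) w" for w
  proof -
    have "?F (Suc m) w = foldr (\<lambda>j u. w j \<circ> u) [1..<Suc m] (w (Suc m))" by simp
    also have "\<dots> = ?F m w \<circ> w (Suc m)" by (rule foldr_comp)
    also have "?F m w = ?F m (restrict w {1..m})" by (rule foldr_cong) auto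
    finally show ?thesis by (rule sym)
  qed
  \<comment> \<open>Only the two outer compositions are opened by the instances of
    \<open>o_apply\<close>; composites of group elements stay intact.\<close>
  then have "((\<lambda>(v, w). v \<circ> w) \<circ> (map_prod (?F m) id \<circ>
      (\<lambda>w. (restrict w {1..m}, w (Suc m))))) w = ?F (Suc m) w" for w
    by (simp only: o_apply[of "case_prod _"] o_apply[of "map_prod _ _"]
      map_prod_simp prod.case id_apply)
  then have "(\<lambda>(v, w). v \<circ> w) \<circ> (map_prod (?F m) id \<circ>
      (\<lambda>w. (restrict w {1..m}, w (Suc m)))) = ?F (Suc m)"
    by (rule ext)
  ultimately show ?case
    by (rule back_subst[of "\<lambda>g. bij_betw g (?A (Suc m)) (P (Suc m))"])
qed

section \<open>Assembling all levels of a good enumeration\<close>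

theorem proposition3p11:
  fixes \<Phi> \<Delta> :: "'a::euclidean_space set"
    and n :: nat
    and \<alpha> :: "nat \<Rightarrow> 'a"
    and ws :: "nat \<Rightarrow> nat list"
  assumes "irreducible_root_system \<Phi>"
    and "simple_roots \<Phi> \<Delta>"
    and "\<not> has_cartan_matrix \<Delta> cartan_F4"
    and "\<not> has_cartan_matrix \<Delta> cartan_E8"
    and "good_enumeration \<Phi> \<Delta> n \<alpha>"
    and "\<And>j. j \<in> {1..n} \<Longrightarrow> longest_rep_word n \<alpha> j (ws j)"
  shows "(\<forall>j\<in>{1..n}. \<forall>T\<in>initial_subgraphs \<alpha> (ws j). \<exists>!w. represents \<alpha> (ws j) T w) \<and>
         bij_betw (\<lambda>T. \<lambda>j\<in>{1..n}. tau \<alpha> (ws j) (T j))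
           (\<Pi>\<^sub>E j\<in>{1..n}. initial_subgraphs \<alpha> (ws j)) (\<Pi>\<^sub>E j\<in>{1..n}. min_coset_reps n \<alpha> j) \<and>
         bij_betw (\<lambda>w. foldr (\<lambda>j u. w j \<circ> u) [1..<Suc n] id)
           (\<Pi>\<^sub>E j\<in>{1..n}. min_coset_reps n \<alpha> j) (weyl_group \<Phi>)"
proof -
  have \<Delta>: "\<Delta> = \<alpha> ` {1..n}" "inj_on \<alpha> {1..n}"
    using assms(5) by (auto simp: good_enumeration_def bij_betw_def)
  interpret based_root_system \<Phi> n \<alpha>
    using assms(1,2) \<Delta> by unfold_locales (auto simp: irreducible_root_system_def)
  \<comment> \<open>Stage \<open>j\<close> of the good enumeration is a braidless level:
    \<open>\<omega>\<close> is the fundamental weight of \<open>\<alpha> j\<close> in the subsystem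
    spanned by the first \<open>j\<close> simple roots.\<close>
  have level: "braidless_level \<Phi> n \<alpha> j (fundamental_weight (\<alpha> ` {1..j}) (\<alpha> j))"
    if j: "j \<in> {1..n}" for j
  proof -
    let ?\<omega> = "fundamental_weight (\<alpha> ` {1..j}) (\<alpha> j)"
    have weight: "pairing ?\<omega> (\<alpha> k) = (if k = j then 1 else 0)" if "k \<in> {1..j}" for k
      using fundamental_weight_props(2)[OF independent_simple, of "{1..j}" "\<alpha> k" "\<alpha> j"]
        inj_on_eq_iff[OF inj, of k j] that j by auto
    have weight_braidless: "braidless_weight (\<Phi> \<inter> span (\<alpha> ` {1..j})) (\<alpha> ` {1..j}) ?\<omega>"
      using assms(5) j by (simp add: good_enumeration_def braidless_root_def)
    \<comment> \<open>Braidlessness quantifies over the Weyl group of the subsystem; since the first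
      \<open>j\<close> simple roots belong to it, every word in \<open>{1..j}\<close> lies in that
      group.\<close>
    have in_weyl: "wp p \<in> weyl_group (\<Phi> \<inter> span (\<alpha> ` {1..j}))" if "set p \<subseteq> {1..j}" for p
    proof -
      have "\<alpha> ` {1..j} \<subseteq> \<Phi> \<inter> span (\<alpha> ` {1..j})"
        using j simple_in_roots span_superset[of "\<alpha> ` {1..j}"] by auto
      then show ?thesis
        using word_prod_in_parabolic[OF that] reflection_group_mono
        unfolding weyl_group_def parabolic_def by blast
    qed
    have "pairing (\<alpha> k) (\<alpha> i) = 0"
      if "set p \<subseteq> {1..j}" "i \<in> {1..j}" "k \<in> {1..j}" "i \<noteq> k"
        "wp p ?\<omega> \<bullet> \<alpha> i > 0" "wp p ?\<omega> \<bullet> \<alpha> k > 0" for p i k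
      using weight_braidless[unfolded braidless_weight_def pairing_pos_iff, rule_format,
          OF in_weyl[OF that(1)], of "\<alpha> i" "\<alpha> k"] that inj_on_eq_iff[OF inj, of i k] j
      by simp
    then have "braidless j ?\<omega>"
      unfolding braidless_def pairing_eq_0_iff by (simp add: inner_commute)
    moreover have "?\<omega> \<bullet> \<alpha> k = 0" if "k \<in> {1..j - 1}" for k
    proof -
      have "k \<in> {1..j}" "k \<noteq> j" using that j by auto
      then show ?thesis using weight[of k] by (simp add: pairing_eq_0_iff[symmetric])
    qed
    moreover have "?\<omega> \<bullet> \<alpha> j > 0" using weight[of j] j by (simp add: pairing_pos_iff[symmetric])
    ultimately show ?thesis using j by unfold_locales
  qed
  show ?thesis
  proof (intro conjI ballI)
    fix j T assume "j \<in> {1..n}" "T \<in> initial_subgraphs \<alpha> (ws j)"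
    then show "\<exists>!w. represents \<alpha> (ws j) T w"
      using braidless_level.ex1_represents[OF level assms(6)] by blast
  next
    show "bij_betw (\<lambda>T. \<lambda>j\<in>{1..n}. tau \<alpha> (ws j) (T j))
        (\<Pi>\<^sub>E j\<in>{1..n}. initial_subgraphs \<alpha> (ws j)) (\<Pi>\<^sub>E j\<in>{1..n}. min_coset_reps n \<alpha> j)"
      by (rule bij_betw_PiE_pointwise) (rule braidless_level.bij_betw_tau[OF level assms(6)])
  next
    show "bij_betw (\<lambda>w. foldr (\<lambda>j u. w j \<circ> u) [1..<Suc n] id)
        (\<Pi>\<^sub>E j\<in>{1..n}. min_coset_reps n \<alpha> j) (weyl_group \<Phi>)"
      unfolding weyl_group_eq_parabolic
      by (rule bij_betw_iterated_factorization)
        (simp_all add: braidless_level.bij_betw_parabolic[OF level] parabolic_0)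
  qed
qed

end
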